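(* Let $(M^{2n+1},\phi,\xi,\eta,g)$ be an almost $\alpha$-para-Kenmotsu manifold. Then $\xi$ is a harmonic vector field if and only if $\xi$ is an eigenvector of the Ricci operator $Q$, i.e. $Q\xi=f\xi$ for some function $f$ on $M$.
   Context: An almost paracontact metric manifold is a smooth manifold $M$ of dimension $2n+1$ with a $(1,1)$-tensor field $\phi$, a vector field $\xi$, a 1-form $\eta$ and a pseudo-Riemannian metric $g$ of signature $(n+1,n)$ such that $\eta(\xi)=1$, $\phi^2=\mathrm{Id}-\eta\otimes\xi$, the eigendistributions of $\phi|_{\ker\eta}$ for the eigenvalues $+1$ and $-1$ both have rank $n$, and $g(\phi X,\phi Y)=-g(X,Y)+\eta(X)\eta(Y)$ (hence $\eta(X)=g(X,\xi)$, $\phi\xi=0$, $\eta\circ\phi=0$). Its fundamental 2-form is $\Phi(X,Y)=g(\phi X,Y)$. It is almost $\alpha$-para-Kenmotsu, where $\alpha$ is a real constant, if $d\eta=0$ and $d\Phi=2\alpha\,\eta\wedge\Phi$ (with $d$ and $\wedge$ normalized compatibly, so that the cyclic sum of $(\nabla_X\Phi)(Y,Z)$ equals $2\alpha$ times the cyclic sum of $\eta(X)\Phi(Y,Z)$). $\nabla$ is the Levi-Civita connection, $R(X,Y)Z=\nabla_X\nabla_YZ-\nabla_Y\nabla_XZ-\nabla_{[X,Y]}Z$, the Ricci tensor is $S(Y,Z)=\mathrm{tr}(X\mapsto R(X,Y)Z)$, and $g(QX,Y)=S(X,Y)$. For a vector field $V$ the rough Laplacian is $\nabla^*\nabla V=-\sum_i\varepsilon_i(\nabla_{E_i}\nabla_{E_i}V-\nabla_{\nabla_{E_i}E_i}V)$,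 where $E_i$ is a local pseudo-orthonormal frame with $g(E_i,E_i)=\varepsilon_i=\pm1$. A vector field $V$ of constant nonzero length $g(V,V)$ is called a harmonic vector field if $\nabla^*\nabla V$ is collinear to $V$, i.e. a function multiple of $V$ (in the paper, this is taken as the definition in the possibly non-compact case). *)

theory Defs
  imports "HOL-Analysis.Analysis"
begin

section \<open>Smooth maps between open subsets of normed spaces\<close>

primrec Ck_on :: "nat \<Rightarrow> 'a::real_normed_vector set \<Rightarrow> ('a \<Rightarrow> 'b::real_normed_vector) \<Rightarrow> bool"
  where
    "Ck_on 0 S f \<longleftrightarrow> continuous_on S f"
  | "Ck_on (Suc k) S f \<longleftrightarrow>
       (\<forall>x\<in>S. f differentiable (at x)) \<and>
       (\<forall>v. Ck_on k S (\<lambda>x. frechet_derivative f (at x) v))"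

definition smooth_on :: "'a::real_normed_vector set \<Rightarrow> ('a \<Rightarrow> 'b::real_normed_vector) \<Rightarrow> bool"
  where "smooth_on S f \<longleftrightarrow> (\<forall>k. Ck_on k S f)"


section \<open>Smooth manifolds\<close>

text \<open>A chart is a pair of its domain and its coordinate map.  The dimension of the
  manifold is \<open>CARD('m)\<close>; the atlas need not be maximal.\<close>

type_synonym ('a, 'm) chart = "'a set \<times> ('a \<Rightarrow> real ^ 'm)"

record ('a, 'm) premanifold =
  mtop :: "'a topology"
  atlas :: "('a, 'm::finite) chart set"

abbreviation pts :: "('a, 'm::finite) premanifold \<Rightarrow> 'a set"
  where "pts M \<equiv> topspace (mtop M)"

definition inv_chart :: "('a, 'm::finite) chart \<Rightarrow> real ^ 'm \<Rightarrow> 'a"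
  where "inv_chart c = inv_into (fst c) (snd c)"

definition transition ::
  "('a, 'm::finite) chart \<Rightarrow> ('a, 'm) chart \<Rightarrow> real ^ 'm \<Rightarrow> real ^ 'm"
  where "transition c d = snd d \<circ> inv_chart c"

definition is_chart :: "'a topology \<Rightarrow> ('a, 'm::finite) chart \<Rightarrow> bool"
  where "is_chart T c \<longleftrightarrow>
    openin T (fst c) \<and> open (snd c ` fst c) \<and>
    homeomorphic_map (subtopology T (fst c)) (top_of_set (snd c ` fst c)) (snd c)"

locale smooth_manifold =
  fixes M :: "('a, 'm::finite) premanifold"
  assumes hausdorff: "Hausdorff_space (mtop M)"
    and second_countable: "second_countable (mtop M)"
    and charts: "c \<in> atlas M \<Longrightarrow> is_chart (mtop M) c"
    and covering: "(\<Union>c\<in>atlas M. fst c) = pts M"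
    and compatible: "c \<in> atlas M \<Longrightarrow> d \<in> atlas M \<Longrightarrow>
      smooth_on (snd c ` (fst c \<inter> fst d)) (transition c d)"


section \<open>Tangent vectors and vector fields\<close>

text \<open>The tangent space at \<open>p\<close> is modelled by \<^typ>\<open>real ^ 'm\<close>: a tangent vector is given by its
  components in the preferred chart \<open>chart_at M p\<close>.  Its components in another chart \<open>c\<close>
  around \<open>p\<close> are obtained by applying \<open>dchart M c p\<close>, the differential at \<open>p\<close> of the
  coordinate map of \<open>c\<close>.  Nothing is required of preferred charts at different points, so
  smoothness of a field is always expressed through its components in a fixed chart.

  Functions, fields and tensor fields are total; their values outside the set under
  consideration are irrelevant.\<close>

definition chart_at :: "('a, 'm::finite) premanifold \<Rightarrow> 'a \<Rightarrow> ('a, 'm) chart"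
  where "chart_at M p = (SOME c. c \<in> atlas M \<and> p \<in> fst c)"

definition dchart ::
  "('a, 'm::finite) premanifold \<Rightarrow> ('a, 'm) chart \<Rightarrow> 'a \<Rightarrow> real ^ 'm \<Rightarrow> real ^ 'm"
  where "dchart M c p =
    frechet_derivative (transition (chart_at M p) c) (at (snd (chart_at M p) p))"

type_synonym ('a, 'm) vfield = "'a \<Rightarrow> real ^ 'm"

definition local_rep ::
  "('a, 'm::finite) premanifold \<Rightarrow> ('a, 'm) chart \<Rightarrow> ('a, 'm) vfield \<Rightarrow> real ^ 'm \<Rightarrow> real ^ 'm"
  where "local_rep M c X = (\<lambda>x. dchart M c (inv_chart c x) (X (inv_chart c x)))"

definition smooth_fun :: "('a, 'm::finite) premanifold \<Rightarrow> 'a set \<Rightarrow> ('a \<Rightarrow> real) \<Rightarrow> bool"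
  where "smooth_fun M U f \<longleftrightarrow>
    (\<forall>c\<in>atlas M. smooth_on (snd c ` (U \<inter> fst c)) (f \<circ> inv_chart c))"

definition smooth_vfield :: "('a, 'm::finite) premanifold \<Rightarrow> 'a set \<Rightarrow> ('a, 'm) vfield \<Rightarrow> bool"
  where "smooth_vfield M U X \<longleftrightarrow>
    (\<forall>c\<in>atlas M. smooth_on (snd c ` (U \<inter> fst c)) (local_rep M c X))"

text \<open>\<open>dirderiv M X f\<close> is the function \<open>X f\<close>.\<close>

definition dirderiv ::
  "('a, 'm::finite) premanifold \<Rightarrow> ('a, 'm) vfield \<Rightarrow> ('a \<Rightarrow> real) \<Rightarrow> 'a \<Rightarrow> real"
  where "dirderiv M X f p =
    frechet_derivative (f \<circ> inv_chart (chart_at M p)) (at (snd (chart_at M p) p)) (X p)"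

text \<open>In any chart, \<open>[X,Y]\<^sup>i = X\<^sup>j \<partial>\<^sub>j Y\<^sup>i - Y\<^sup>j \<partial>\<^sub>j X\<^sup>i\<close>.\<close>

definition lie_bracket ::
  "('a, 'm::finite) premanifold \<Rightarrow> ('a, 'm) vfield \<Rightarrow> ('a, 'm) vfield \<Rightarrow> ('a, 'm) vfield"
  where "lie_bracket M X Y p =
    (let c = chart_at M p; x = snd c p in
      frechet_derivative (local_rep M c Y) (at x) (X p)
      - frechet_derivative (local_rep M c X) (at x) (Y p))"


section \<open>Tensor fields\<close>

text \<open>A tensor field is a pointwise multilinear map that takes smooth vector fields on every
  open set to smooth functions, respectively smooth vector fields.\<close>

definition one_form :: "('a, 'm::finite) premanifold \<Rightarrow> ('a \<Rightarrow> real ^ 'm \<Rightarrow> real) \<Rightarrow> bool"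
  where "one_form M \<omega> \<longleftrightarrow>
    (\<forall>p\<in>pts M. linear (\<omega> p)) \<and>
    (\<forall>U X. openin (mtop M) U \<and> smooth_vfield M U X \<longrightarrow> smooth_fun M U (\<lambda>p. \<omega> p (X p)))"

definition endo_field ::
  "('a, 'm::finite) premanifold \<Rightarrow> ('a \<Rightarrow> real ^ 'm \<Rightarrow> real ^ 'm) \<Rightarrow> bool"
  where "endo_field M A \<longleftrightarrow>
    (\<forall>p\<in>pts M. linear (A p)) \<and>
    (\<forall>U X. openin (mtop M) U \<and> smooth_vfield M U X \<longrightarrow> smooth_vfield M U (\<lambda>p. A p (X p)))"

definition bilinear_field ::
  "('a, 'm::finite) premanifold \<Rightarrow> ('a \<Rightarrow> real ^ 'm \<Rightarrow> real ^ 'm \<Rightarrow> real) \<Rightarrow> bool"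
  where "bilinear_field M B \<longleftrightarrow>
    (\<forall>p\<in>pts M. bilinear (B p)) \<and>
    (\<forall>U X Y. openin (mtop M) U \<and> smooth_vfield M U X \<and> smooth_vfield M U Y \<longrightarrow>
      smooth_fun M U (\<lambda>p. B p (X p) (Y p)))"

text \<open>Exterior derivatives and the wedge product are normalized without numerical factors, so
  that \<open>d \<Phi>\<close> is the cyclic sum of \<open>(\<nabla>\<^sub>X \<Phi>)(Y,Z)\<close> and \<open>\<eta> \<and> \<Phi>\<close> the cyclic sum of
  \<open>\<eta>(X) \<Phi>(Y,Z)\<close>.\<close>

definition d1 ::
  "('a, 'm::finite) premanifold \<Rightarrow> ('a \<Rightarrow> real ^ 'm \<Rightarrow> real) \<Rightarrow>
    ('a, 'm) vfield \<Rightarrow> ('a, 'm) vfield \<Rightarrow> 'a \<Rightarrow> real"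
  where "d1 M \<omega> X Y p =
    dirderiv M X (\<lambda>q. \<omega> q (Y q)) p - dirderiv M Y (\<lambda>q. \<omega> q (X q)) p
    - \<omega> p (lie_bracket M X Y p)"

definition d2 ::
  "('a, 'm::finite) premanifold \<Rightarrow> ('a \<Rightarrow> real ^ 'm \<Rightarrow> real ^ 'm \<Rightarrow> real) \<Rightarrow>
    ('a, 'm) vfield \<Rightarrow> ('a, 'm) vfield \<Rightarrow> ('a, 'm) vfield \<Rightarrow> 'a \<Rightarrow> real"
  where "d2 M \<Omega> X Y Z p =
    dirderiv M X (\<lambda>q. \<Omega> q (Y q) (Z q)) p
    + dirderiv M Y (\<lambda>q. \<Omega> q (Z q) (X q)) p
    + dirderiv M Z (\<lambda>q. \<Omega> q (X q) (Y q)) p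
    - \<Omega> p (lie_bracket M X Y p) (Z p)
    - \<Omega> p (lie_bracket M Y Z p) (X p)
    - \<Omega> p (lie_bracket M Z X p) (Y p)"

definition wedge12 ::
  "('a \<Rightarrow> real ^ 'm \<Rightarrow> real) \<Rightarrow> ('a \<Rightarrow> real ^ 'm \<Rightarrow> real ^ 'm \<Rightarrow> real) \<Rightarrow>
    'a \<Rightarrow> real ^ 'm \<Rightarrow> real ^ 'm \<Rightarrow> real ^ 'm \<Rightarrow> real"
  where "wedge12 \<omega> \<Omega> p u v w = \<omega> p u * \<Omega> p v w + \<omega> p v * \<Omega> p w u + \<omega> p w * \<Omega> p u v"


section \<open>Pseudo-Riemannian metrics and curvature\<close>

text \<open>A symmetric bilinear form has signature \<open>(r, s)\<close> if it has a pseudo-orthonormal basis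
  with \<open>r\<close> vectors of square \<open>1\<close> and \<open>s\<close> vectors of square \<open>-1\<close>.  The conditions below force
  \<open>r + s = CARD('m)\<close>, linear independence of the vectors \<open>b i\<close>, and nondegeneracy.\<close>

definition has_signature :: "(real ^ 'm \<Rightarrow> real ^ 'm \<Rightarrow> real) \<Rightarrow> nat \<Rightarrow> nat \<Rightarrow> bool"
  where "has_signature B r s \<longleftrightarrow>
    (\<exists>b :: 'm::finite \<Rightarrow> real ^ 'm.
      (\<forall>i j. i \<noteq> j \<longrightarrow> B (b i) (b j) = 0) \<and>
      (\<forall>i. B (b i) (b i) = 1 \<or> B (b i) (b i) = -1) \<and>
      card {i. B (b i) (b i) = 1} = r \<and>
      card {i. B (b i) (b i) = -1} = s)"

locale pseudo_riemannian = smooth_manifold M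
  for M :: "('a, 'm::finite) premanifold" +
  fixes r s :: nat
    and g :: "'a \<Rightarrow> real ^ 'm \<Rightarrow> real ^ 'm \<Rightarrow> real"
  assumes metric_tensor: "bilinear_field M g"
    and metric_sym: "p \<in> pts M \<Longrightarrow> g p u v = g p v u"
    and metric_signature: "p \<in> pts M \<Longrightarrow> has_signature (g p) r s"

text \<open>Vector fields are differentiated on open subsets.  The value of \<open>nabla X Y\<close> at \<open>p\<close> is
  determined by the axioms (Koszul formula) as soon as \<open>X\<close> and \<open>Y\<close> are smooth near \<open>p\<close>.\<close>

type_synonym ('a, 'm) conn = "('a, 'm) vfield \<Rightarrow> ('a, 'm) vfield \<Rightarrow> ('a, 'm) vfield"

locale levi_civita =
  fixes M :: "('a, 'm::finite) premanifold"
    and g :: "'a \<Rightarrow> real ^ 'm \<Rightarrow> real ^ 'm \<Rightarrow> real"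
    and nabla :: "('a, 'm) conn"
  assumes nabla_smooth:
    "\<lbrakk>openin (mtop M) U; smooth_vfield M U X; smooth_vfield M U Y\<rbrakk>
      \<Longrightarrow> smooth_vfield M U (nabla X Y)"
    and nabla_add_left:
    "\<lbrakk>openin (mtop M) U; smooth_vfield M U X; smooth_vfield M U X'; smooth_vfield M U Y; p \<in> U\<rbrakk>
      \<Longrightarrow> nabla (\<lambda>q. X q + X' q) Y p = nabla X Y p + nabla X' Y p"
    and nabla_scale_left:
    "\<lbrakk>openin (mtop M) U; smooth_fun M U f; smooth_vfield M U X; smooth_vfield M U Y; p \<in> U\<rbrakk>
      \<Longrightarrow> nabla (\<lambda>q. f q *\<^sub>R X q) Y p = f p *\<^sub>R nabla X Y p"
    and nabla_add_right:
    "\<lbrakk>openin (mtop M) U; smooth_vfield M U X; smooth_vfield M U Y; smooth_vfield M U Y'; p \<in> U\<rbrakk>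
      \<Longrightarrow> nabla X (\<lambda>q. Y q + Y' q) p = nabla X Y p + nabla X Y' p"
    and nabla_leibniz:
    "\<lbrakk>openin (mtop M) U; smooth_fun M U f; smooth_vfield M U X; smooth_vfield M U Y; p \<in> U\<rbrakk>
      \<Longrightarrow> nabla X (\<lambda>q. f q *\<^sub>R Y q) p = dirderiv M X f p *\<^sub>R Y p + f p *\<^sub>R nabla X Y p"
    and nabla_torsion_free:
    "\<lbrakk>openin (mtop M) U; smooth_vfield M U X; smooth_vfield M U Y; p \<in> U\<rbrakk>
      \<Longrightarrow> nabla X Y p - nabla Y X p = lie_bracket M X Y p"
    and nabla_metric:
    "\<lbrakk>openin (mtop M) U; smooth_vfield M U X; smooth_vfield M U Y; smooth_vfield M U Z; p \<in> U\<rbrakk>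
      \<Longrightarrow> dirderiv M X (\<lambda>q. g q (Y q) (Z q)) p
          = g p (nabla X Y p) (Z p) + g p (Y p) (nabla X Z p)"

definition curvature ::
  "('a, 'm::finite) premanifold \<Rightarrow> ('a, 'm) conn \<Rightarrow>
    ('a, 'm) vfield \<Rightarrow> ('a, 'm) vfield \<Rightarrow> ('a, 'm) vfield \<Rightarrow> ('a, 'm) vfield"
  where "curvature M nabla X Y Z p =
    nabla X (nabla Y Z) p - nabla Y (nabla X Z) p - nabla (lie_bracket M X Y) Z p"

text \<open>The vector field on the domain of \<open>c\<close> with constant components \<open>v\<close> in the chart \<open>c\<close>,
  i.e. the combination of the coordinate fields of \<open>c\<close> with coefficients \<open>v $ i\<close>.\<close>

definition const_field ::
  "('a, 'm::finite) premanifold \<Rightarrow> ('a, 'm) chart \<Rightarrow> real ^ 'm \<Rightarrow> ('a, 'm) vfield"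
  where "const_field M c v = (\<lambda>q.
    frechet_derivative (transition c (chart_at M q)) (at (snd c q)) v)"

text \<open>The curvature tensor at \<open>p\<close>: tangent vectors are extended to local vector fields.
  Since the curvature is tensorial, the choice of the extension does not matter.\<close>

definition curvature_at ::
  "('a, 'm::finite) premanifold \<Rightarrow> ('a, 'm) conn \<Rightarrow>
    'a \<Rightarrow> real ^ 'm \<Rightarrow> real ^ 'm \<Rightarrow> real ^ 'm \<Rightarrow> real ^ 'm"
  where "curvature_at M nabla p u v w =
    (let ext = const_field M (chart_at M p) in curvature M nabla (ext u) (ext v) (ext w) p)"

definition ricci ::
  "('a, 'm::finite) premanifold \<Rightarrow> ('a, 'm) conn \<Rightarrow> 'a \<Rightarrow> real ^ 'm \<Rightarrow> real ^ 'm \<Rightarrow> real"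
  where "ricci M nabla p v w = trace (matrix (\<lambda>u. curvature_at M nabla p u v w))"

definition ricci_operator ::
  "('a, 'm::finite) premanifold \<Rightarrow> ('a \<Rightarrow> real ^ 'm \<Rightarrow> real ^ 'm \<Rightarrow> real) \<Rightarrow>
    ('a, 'm) conn \<Rightarrow> 'a \<Rightarrow> real ^ 'm \<Rightarrow> real ^ 'm"
  where "ricci_operator M g nabla p v = (THE w. \<forall>u. g p w u = ricci M nabla p v u)"


section \<open>Harmonic vector fields\<close>

definition pseudo_orthonormal_frame ::
  "('a, 'm::finite) premanifold \<Rightarrow> ('a \<Rightarrow> real ^ 'm \<Rightarrow> real ^ 'm \<Rightarrow> real) \<Rightarrow>
    'a set \<Rightarrow> ('m \<Rightarrow> ('a, 'm) vfield) \<Rightarrow> ('m \<Rightarrow> real) \<Rightarrow> bool"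
  where "pseudo_orthonormal_frame M g U E \<epsilon> \<longleftrightarrow>
    openin (mtop M) U \<and>
    (\<forall>i. smooth_vfield M U (E i)) \<and>
    (\<forall>i. \<epsilon> i = 1 \<or> \<epsilon> i = -1) \<and>
    (\<forall>p\<in>U. \<forall>i j. g p (E i p) (E j p) = (if i = j then \<epsilon> i else 0))"

text \<open>The value does not depend on the chosen local frame.\<close>

definition rough_laplacian ::
  "('a, 'm::finite) premanifold \<Rightarrow> ('a \<Rightarrow> real ^ 'm \<Rightarrow> real ^ 'm \<Rightarrow> real) \<Rightarrow>
    ('a, 'm) conn \<Rightarrow> ('a, 'm) vfield \<Rightarrow> ('a, 'm) vfield"
  where "rough_laplacian M g nabla V p =
    (let (E, \<epsilon>) = (SOME (E, \<epsilon>). \<exists>U. p \<in> U \<and> pseudo_orthonormal_frame M g U E \<epsilon>) in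
      - (\<Sum>i\<in>UNIV. \<epsilon> i *\<^sub>R (nabla (E i) (nabla (E i) V) p - nabla (nabla (E i) (E i)) V p)))"

definition harmonic_vfield ::
  "('a, 'm::finite) premanifold \<Rightarrow> ('a \<Rightarrow> real ^ 'm \<Rightarrow> real ^ 'm \<Rightarrow> real) \<Rightarrow>
    ('a, 'm) conn \<Rightarrow> ('a, 'm) vfield \<Rightarrow> bool"
  where "harmonic_vfield M g nabla V \<longleftrightarrow>
    smooth_vfield M (pts M) V \<and>
    (\<exists>k. k \<noteq> 0 \<and> (\<forall>p\<in>pts M. g p (V p) (V p) = k)) \<and>
    (\<exists>f. \<forall>p\<in>pts M. rough_laplacian M g nabla V p = f p *\<^sub>R V p)"


section \<open>Almost para-Kenmotsu structures\<close>

locale almost_paracontact_metric = pseudo_riemannian M "n + 1" n g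
  for M :: "('a, 'm::finite) premanifold"
    and n :: nat
    and g :: "'a \<Rightarrow> real ^ 'm \<Rightarrow> real ^ 'm \<Rightarrow> real" +
  fixes \<phi> :: "'a \<Rightarrow> real ^ 'm \<Rightarrow> real ^ 'm"
    and \<xi> :: "('a, 'm) vfield"
    and \<eta> :: "'a \<Rightarrow> real ^ 'm \<Rightarrow> real"
  assumes dimension: "CARD('m) = 2 * n + 1"
    and phi_tensor: "endo_field M \<phi>"
    and xi_smooth: "smooth_vfield M (pts M) \<xi>"
    and eta_form: "one_form M \<eta>"
    and eta_xi: "p \<in> pts M \<Longrightarrow> \<eta> p (\<xi> p) = 1"
    and phi_phi: "p \<in> pts M \<Longrightarrow> \<phi> p (\<phi> p v) = v - \<eta> p v *\<^sub>R \<xi> p"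
    and rank_plus: "p \<in> pts M \<Longrightarrow> dim {v. \<eta> p v = 0 \<and> \<phi> p v = v} = n"
    and rank_minus: "p \<in> pts M \<Longrightarrow> dim {v. \<eta> p v = 0 \<and> \<phi> p v = - v} = n"
    and compatible_metric:
    "p \<in> pts M \<Longrightarrow> g p (\<phi> p u) (\<phi> p v) = - g p u v + \<eta> p u * \<eta> p v"

definition fundamental_form ::
  "('a \<Rightarrow> real ^ 'm \<Rightarrow> real ^ 'm \<Rightarrow> real) \<Rightarrow> ('a \<Rightarrow> real ^ 'm \<Rightarrow> real ^ 'm) \<Rightarrow>
    'a \<Rightarrow> real ^ 'm \<Rightarrow> real ^ 'm \<Rightarrow> real"
  where "fundamental_form g \<phi> p u v = g p (\<phi> p u) v"

locale almost_para_kenmotsu = almost_paracontact_metric M n g \<phi> \<xi> \<eta>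
  for M :: "('a, 'm::finite) premanifold"
    and n :: nat
    and g :: "'a \<Rightarrow> real ^ 'm \<Rightarrow> real ^ 'm \<Rightarrow> real"
    and \<phi> :: "'a \<Rightarrow> real ^ 'm \<Rightarrow> real ^ 'm"
    and \<xi> :: "('a, 'm) vfield"
    and \<eta> :: "'a \<Rightarrow> real ^ 'm \<Rightarrow> real" +
  fixes \<alpha> :: real
  assumes d_eta:
    "\<lbrakk>openin (mtop M) U; smooth_vfield M U X; smooth_vfield M U Y; p \<in> U\<rbrakk>
      \<Longrightarrow> d1 M \<eta> X Y p = 0"
    and d_Phi:
    "\<lbrakk>openin (mtop M) U; smooth_vfield M U X; smooth_vfield M U Y; smooth_vfield M U Z; p \<in> U\<rbrakk>
      \<Longrightarrow> d2 M (fundamental_form g \<phi>) X Y Z p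
          = 2 * \<alpha> * wedge12 \<eta> (fundamental_form g \<phi>) p (X p) (Y p) (Z p)"

end

theory Submission
  imports Defs
begin

text \<open>
  The theorem is the pointwise identity \<open>Q \<xi> = - \<nabla>\<^sup>*\<nabla> \<xi>\<close>
  (\<open>ricci_operator_xi\<close>): once it holds, one side is a multiple of \<open>\<xi>\<close> exactly if the
  other is, with the opposite factor.  Smoothness and the constant length \<open>g(\<xi>, \<xi>) = 1\<close> come
  with the structure.

  Let \<open>A X = \<nabla>\<^sub>X \<xi>\<close>.  As \<open>\<eta> = g(\<cdot>, \<xi>)\<close> is closed, \<open>A\<close> is self-adjoint, and so is
  \<open>\<nabla>\<^sub>X A\<close> for every \<open>X\<close>.  Since \<open>R(X, Y) \<xi> = (\<nabla>\<^sub>X A) Y - (\<nabla>\<^sub>Y A) X\<close>, one gets for a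
  pseudo-orthonormal frame
  \<open>- g(\<nabla>\<^sup>*\<nabla> \<xi>, Z) = \<Sum>\<^sub>i \<epsilon>\<^sub>i g((\<nabla>\<^sub>E A) E, Z) = \<Sum>\<^sub>i \<epsilon>\<^sub>i g((\<nabla>\<^sub>E A) Z, E)
     = \<Sum>\<^sub>i \<epsilon>\<^sub>i g(R(E, Z) \<xi>, E) + \<Sum>\<^sub>i \<epsilon>\<^sub>i g((\<nabla>\<^sub>Z A) E, E) = S(Z, \<xi>) + Z(tr A)\<close>
  with \<open>E = E\<^sub>i\<close> (\<open>metric_trace_nabla2_xi\<close>).  Hence everything rests on \<open>tr A\<close> being
  constant; this is where the second structure equation enters.

  Evaluated on \<open>\<xi>, X, Y\<close>, the equation \<open>d \<Phi> = 2 \<alpha> \<eta> \<and> \<Phi>\<close> reads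
  \<open>\<nabla>\<^sub>\<xi> \<phi> + \<phi> A + A \<phi> = 2 \<alpha> \<phi>\<close> (\<open>nabla_xi_phi\<close>).  Differentiating
  \<open>\<phi>\<^sup>2 = Id - \<eta> \<otimes> \<xi>\<close> along \<open>\<xi>\<close> and using \<open>A \<xi> = 0\<close> shows that \<open>\<nabla>\<^sub>\<xi> \<phi>\<close> anticommutes with
  \<open>\<phi>\<close>, so composing with \<open>\<phi>\<close> and taking traces removes this term and leaves
  \<open>tr A = 2 n \<alpha>\<close> (\<open>trace_shape\<close>).

  The rest supplies the foundations.  The rough Laplacian is computed with a frame chosen
  by a choice operator, so local pseudo-orthonormal frames have to exist; the connection acts on total
  functions, so its locality has to be derived from the axioms; and the curvature at a point is
  computed with coordinate fields, whereas frames and \<open>\<xi>\<close> are not coordinate fields.  For this last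
  point, self-adjointness does most of the work: an identity \<open>g(T(Y), Z) = g(T(Z), Y)\<close>, or its skew
  variant, shows that \<open>T(Y)\<close> at \<open>p\<close> depends only on the value of \<open>Y\<close> at \<open>p\<close>.
\<close>

section \<open>Calculus of smooth maps on open sets\<close>

lemma Ck_on_cong:
  assumes "open S" "\<And>x. x \<in> S \<Longrightarrow> f x = g x" "Ck_on k S f"
  shows "Ck_on k S g"
  using assms(2,3)
proof (induction k arbitrary: f g)
  case 0
  then show ?case by (simp cong: continuous_on_cong_simp)
next
  case (Suc k)
  have "g differentiable (at x)" if "x \<in> S" for x
    using has_derivative_transform_within_open[of f _ x UNIV S g] Suc.prems that assms(1)
    by (simp add: differentiable_def) meson
  moreover have "Ck_on k S (\<lambda>x. frechet_derivative g (at x) v)" for v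
  proof (rule Suc.IH)
    show "Ck_on k S (\<lambda>x. frechet_derivative f (at x) v)" using Suc.prems by simp
    show "frechet_derivative f (at x) v = frechet_derivative g (at x) v" if "x \<in> S" for x
      using frechet_derivative_transform_within_open[of f x S g] Suc.prems that assms(1) by simp
  qed
  ultimately show ?case by simp
qed

lemma Ck_on_subset: "Ck_on k S f \<Longrightarrow> T \<subseteq> S \<Longrightarrow> Ck_on k T f"
  by (induction k arbitrary: f) (auto intro: continuous_on_subset)

lemma Ck_on_Suc_imp: "Ck_on (Suc k) S f \<Longrightarrow> Ck_on k S f"
proof (induction k arbitrary: f)
  case 0
  then show ?case
    by (simp add: continuous_at_imp_continuous_on differentiable_imp_continuous_within)
next
  case (Suc k)
  then show ?case by (metis Ck_on.simps(2))
qed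

lemma Ck_on_const: "Ck_on k S (\<lambda>_. c)"
  by (induction k arbitrary: c) auto

lemma Ck_on_add:
  assumes "open S" "Ck_on k S f" "Ck_on k S g"
  shows "Ck_on k S (\<lambda>x. f x + g x)"
  using assms(2,3)
proof (induction k arbitrary: f g)
  case 0
  then show ?case by (simp add: continuous_on_add)
next
  case (Suc k)
  have d: "((\<lambda>x. f x + g x) has_derivative
      (\<lambda>v. frechet_derivative f (at x) v + frechet_derivative g (at x) v)) (at x)" if "x \<in> S" for x
    using Suc.prems that by (intro has_derivative_add) (auto simp: frechet_derivative_works[symmetric])
  have "Ck_on k S (\<lambda>x. frechet_derivative (\<lambda>x. f x + g x) (at x) v)" for v
  proof (rule Ck_on_cong[OF assms(1)])
    show "Ck_on k S (\<lambda>x. frechet_derivative f (at x) v + frechet_derivative g (at x) v)"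
      using Suc by simp
    show "frechet_derivative f (at x) v + frechet_derivative g (at x) v
        = frechet_derivative (\<lambda>x. f x + g x) (at x) v" if "x \<in> S" for x
      using frechet_derivative_at[OF d[OF that]] by (rule fun_cong)
  qed
  then show ?case using d by (auto simp: differentiable_def)
qed

lemma (in bounded_bilinear) Ck_on_prod:
  assumes "open S" "Ck_on k S f" "Ck_on k S g"
  shows "Ck_on k S (\<lambda>x. prod (f x) (g x))"
  using assms(2,3)
proof (induction k arbitrary: f g)
  case 0
  then show ?case by (simp add: continuous_on)
next
  case (Suc k)
  have d: "((\<lambda>x. prod (f x) (g x)) has_derivative
      (\<lambda>v. prod (f x) (frechet_derivative g (at x) v) + prod (frechet_derivative f (at x) v) (g x))) (at x)"
    if "x \<in> S" for x
    using Suc.prems that by (intro FDERIV) (auto simp: frechet_derivative_works[symmetric])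
  have "Ck_on k S (\<lambda>x. frechet_derivative (\<lambda>x. prod (f x) (g x)) (at x) v)" for v
  proof (rule Ck_on_cong[OF assms(1)])
    show "Ck_on k S (\<lambda>x. prod (f x) (frechet_derivative g (at x) v)
        + prod (frechet_derivative f (at x) v) (g x))"
      using Suc.prems by (intro Ck_on_add assms(1) Suc.IH) (auto intro: Ck_on_Suc_imp)
    show "prod (f x) (frechet_derivative g (at x) v) + prod (frechet_derivative f (at x) v) (g x)
        = frechet_derivative (\<lambda>x. prod (f x) (g x)) (at x) v" if "x \<in> S" for x
      using frechet_derivative_at[OF d[OF that]] by (rule fun_cong)
  qed
  then show ?case using d by (auto simp: differentiable_def)
qed

lemma Ck_on_sum:
  assumes "open S" "\<And>i. i \<in> I \<Longrightarrow> Ck_on k S (f i)"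
  shows "Ck_on k S (\<lambda>x. \<Sum>i\<in>I. f i x)"
  using assms(2)
  by (induction I rule: infinite_finite_induct) (auto intro: Ck_on_const Ck_on_add[OF assms(1)])

lemma linear_eq_sum_Basis:
  fixes L :: "'a::euclidean_space \<Rightarrow> 'b::real_vector"
  assumes "linear L"
  shows "L v = (\<Sum>b\<in>Basis. (v \<bullet> b) *\<^sub>R L b)"
proof -
  have "L v = L (\<Sum>b\<in>Basis. (v \<bullet> b) *\<^sub>R b)" by (simp add: euclidean_representation)
  also have "\<dots> = (\<Sum>b\<in>Basis. (v \<bullet> b) *\<^sub>R L b)"
    using assms by (simp add: linear_sum linear_scale)
  finally show ?thesis .
qed

lemma Ck_on_compose:
  fixes g :: "'a::real_normed_vector \<Rightarrow> 'b::euclidean_space"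
  assumes "open S" "open T" "g ` S \<subseteq> T" "Ck_on k S g" "Ck_on k T f"
  shows "Ck_on k S (\<lambda>x. f (g x))"
  using assms(4,5)
proof (induction k arbitrary: f)
  case 0
  then show ?case using continuous_on_compose2[of T f S g] assms(3) by simp
next
  case (Suc k)
  have d: "((\<lambda>x. f (g x)) has_derivative
      (\<lambda>v. frechet_derivative f (at (g x)) (frechet_derivative g (at x) v))) (at x)" if "x \<in> S" for x
  proof -
    have "(g has_derivative frechet_derivative g (at x)) (at x)"
      using Suc.prems that by (simp add: frechet_derivative_works[symmetric])
    moreover have "(f has_derivative frechet_derivative f (at (g x))) (at (g x))"
      using Suc.prems that assms(3) by (auto simp: frechet_derivative_works[symmetric])
    ultimately show ?thesis by (rule has_derivative_compose)
  qed
  have "Ck_on k S (\<lambda>x. frechet_derivative (\<lambda>x. f (g x)) (at x) v)" for v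
  proof (rule Ck_on_cong[OF assms(1)])
    show "Ck_on k S (\<lambda>x. \<Sum>b\<in>Basis. (frechet_derivative g (at x) v \<bullet> b)
        *\<^sub>R frechet_derivative f (at (g x)) b)"
    proof (intro Ck_on_sum assms(1) bounded_bilinear.Ck_on_prod[OF bounded_bilinear_scaleR]
        bounded_bilinear.Ck_on_prod[OF bounded_bilinear_inner] Ck_on_const)
      show "Ck_on k S (\<lambda>x. frechet_derivative g (at x) v)" using Suc.prems by simp
      show "Ck_on k S (\<lambda>x. frechet_derivative f (at (g x)) b)" for b
        using Suc.prems by (intro Suc.IH) (auto intro: Ck_on_Suc_imp)
    qed
    show "(\<Sum>b\<in>Basis. (frechet_derivative g (at x) v \<bullet> b) *\<^sub>R frechet_derivative f (at (g x)) b)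
        = frechet_derivative (\<lambda>x. f (g x)) (at x) v" if "x \<in> S" for x
    proof -
      have "linear (frechet_derivative f (at (g x)))"
        using Suc.prems that assms(3) by (intro linear_frechet_derivative) auto
      then show ?thesis
        using fun_cong[OF frechet_derivative_at[OF d[OF that]], of v] linear_eq_sum_Basis by metis
    qed
  qed
  then show ?case using d by (auto simp: differentiable_def)
qed

text \<open>All exponents have to be treated at once: the derivative of \<open>f powr a\<close> involves
  \<open>f powr (a - 1)\<close>.\<close>

lemma Ck_on_powr:
  fixes f :: "'a::real_normed_vector \<Rightarrow> real"
  assumes "open S" "\<And>x. x \<in> S \<Longrightarrow> f x > 0" "Ck_on k S f"
  shows "Ck_on k S (\<lambda>x. f x powr a)"
  using assms(3)
proof (induction k arbitrary: a)
  case 0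
  then show ?case using assms(2) by (fastforce intro!: continuous_on_powr)
next
  case (Suc k)
  have d: "((\<lambda>x. f x powr a) has_derivative
      (\<lambda>v. a * (f x powr (a - 1) * frechet_derivative f (at x) v))) (at x)" if "x \<in> S" for x
  proof -
    have "(f has_derivative frechet_derivative f (at x)) (at x)"
      using Suc.prems that by (simp add: frechet_derivative_works[symmetric])
    moreover have "((\<lambda>t. t powr a) has_derivative (\<lambda>h. a * f x powr (a - 1) * h)) (at (f x))"
      using has_real_derivative_powr[OF assms(2)[OF that], of a]
      by (simp add: has_field_derivative_def)
    ultimately show ?thesis
      unfolding mult.assoc[symmetric] by (rule has_derivative_compose)
  qed
  have "Ck_on k S (\<lambda>x. frechet_derivative (\<lambda>x. f x powr a) (at x) v)" for v
  proof (rule Ck_on_cong[OF assms(1)])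
    show "Ck_on k S (\<lambda>x. a * (f x powr (a - 1) * frechet_derivative f (at x) v))"
      using Suc.prems by (intro bounded_bilinear.Ck_on_prod[OF bounded_bilinear_mult]
          Ck_on_const Suc.IH assms(1)) (auto intro: Ck_on_Suc_imp)
    show "a * (f x powr (a - 1) * frechet_derivative f (at x) v)
        = frechet_derivative (\<lambda>x. f x powr a) (at x) v" if "x \<in> S" for x
      using frechet_derivative_at[OF d[OF that]] by (rule fun_cong)
  qed
  then show ?case using d by (auto simp: differentiable_def)
qed

lemma smooth_on_cong:
  "open S \<Longrightarrow> (\<And>x. x \<in> S \<Longrightarrow> f x = g x) \<Longrightarrow> smooth_on S f \<Longrightarrow> smooth_on S g"
  unfolding smooth_on_def by (blast intro: Ck_on_cong)

lemma smooth_on_subset: "smooth_on S f \<Longrightarrow> T \<subseteq> S \<Longrightarrow> smooth_on T f"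
  unfolding smooth_on_def by (blast intro: Ck_on_subset)

lemma smooth_on_const: "smooth_on S (\<lambda>_. c)"
  unfolding smooth_on_def by (blast intro: Ck_on_const)

lemma smooth_on_add:
  "open S \<Longrightarrow> smooth_on S f \<Longrightarrow> smooth_on S g \<Longrightarrow> smooth_on S (\<lambda>x. f x + g x)"
  unfolding smooth_on_def by (blast intro: Ck_on_add)

lemma smooth_on_sum:
  "open S \<Longrightarrow> (\<And>i. i \<in> I \<Longrightarrow> smooth_on S (f i)) \<Longrightarrow> smooth_on S (\<lambda>x. \<Sum>i\<in>I. f i x)"
  unfolding smooth_on_def by (blast intro: Ck_on_sum)

lemma (in bounded_bilinear) smooth_on_prod:
  "open S \<Longrightarrow> smooth_on S f \<Longrightarrow> smooth_on S g \<Longrightarrow> smooth_on S (\<lambda>x. prod (f x) (g x))"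
  unfolding smooth_on_def by (blast intro: Ck_on_prod)

lemmas smooth_on_scaleR = bounded_bilinear.smooth_on_prod[OF bounded_bilinear_scaleR]
lemmas smooth_on_mult = bounded_bilinear.smooth_on_prod[OF bounded_bilinear_mult]
lemmas smooth_on_inner = bounded_bilinear.smooth_on_prod[OF bounded_bilinear_inner]

lemma smooth_on_compose:
  fixes g :: "'a::real_normed_vector \<Rightarrow> 'b::euclidean_space"
  shows "\<lbrakk>open S; open T; g ` S \<subseteq> T; smooth_on S g; smooth_on T f\<rbrakk> \<Longrightarrow> smooth_on S (\<lambda>x. f (g x))"
  unfolding smooth_on_def by (blast intro: Ck_on_compose)

lemma smooth_on_powr:
  fixes f :: "'a::real_normed_vector \<Rightarrow> real"
  shows "\<lbrakk>open S; \<And>x. x \<in> S \<Longrightarrow> f x > 0; smooth_on S f\<rbrakk> \<Longrightarrow> smooth_on S (\<lambda>x. f x powr a)"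
  unfolding smooth_on_def by (blast intro: Ck_on_powr)

lemma smooth_on_differentiable: "smooth_on S f \<Longrightarrow> x \<in> S \<Longrightarrow> f differentiable (at x)"
  unfolding smooth_on_def by (metis Ck_on.simps(2))

lemma smooth_on_continuous: "smooth_on S f \<Longrightarrow> continuous_on S f"
  unfolding smooth_on_def by (metis Ck_on.simps(1))

lemma smooth_on_has_derivative:
  "smooth_on S f \<Longrightarrow> x \<in> S \<Longrightarrow> (f has_derivative frechet_derivative f (at x)) (at x)"
  by (simp add: frechet_derivative_works[symmetric] smooth_on_differentiable)

lemma smooth_on_frechet_derivative:
  "smooth_on S f \<Longrightarrow> smooth_on S (\<lambda>x. frechet_derivative f (at x) v)"
  unfolding smooth_on_def by (metis Ck_on.simps(2))

lemma smooth_on_frechet_derivative_field: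
  fixes f :: "'a::euclidean_space \<Rightarrow> 'b::real_normed_vector"
  assumes "open S" "smooth_on S f" "smooth_on S w"
  shows "smooth_on S (\<lambda>x. frechet_derivative f (at x) (w x))"
proof (rule smooth_on_cong[OF assms(1)])
  show "smooth_on S (\<lambda>x. \<Sum>b\<in>Basis. (w x \<bullet> b) *\<^sub>R frechet_derivative f (at x) b)"
    by (intro smooth_on_sum smooth_on_scaleR smooth_on_inner smooth_on_frechet_derivative
        smooth_on_const assms)
  show "(\<Sum>b\<in>Basis. (w x \<bullet> b) *\<^sub>R frechet_derivative f (at x) b) = frechet_derivative f (at x) (w x)"
    if "x \<in> S" for x
    by (rule linear_eq_sum_Basis[symmetric])
      (use assms(2) that in \<open>auto intro: linear_frechet_derivative smooth_on_differentiable\<close>)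
qed

text \<open>The product rule for the pairing of \<open>df\<close> with a variable vector: the last summand is the second
  derivative of \<open>f\<close>, with the vector frozen at \<open>x\<close>.\<close>

lemma frechet_derivative_along_field:
  fixes f :: "'a::euclidean_space \<Rightarrow> 'b::real_normed_vector"
  assumes "open S" "smooth_on S f" "smooth_on S w" "x \<in> S"
  shows "frechet_derivative (\<lambda>y. frechet_derivative f (at y) (w y)) (at x) h
    = frechet_derivative f (at x) (frechet_derivative w (at x) h)
      + frechet_derivative (\<lambda>y. frechet_derivative f (at y) (w x)) (at x) h"
proof -
  let ?D = "\<lambda>y. frechet_derivative f (at y)"
  have lin: "linear (?D y)" if "y \<in> S" for y
    using assms(2) that by (auto intro: linear_frechet_derivative smooth_on_differentiable)
  have db: "((\<lambda>y. ?D y b) has_derivative frechet_derivative (\<lambda>y. ?D y b) (at x)) (at x)" for b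
    by (rule smooth_on_has_derivative[OF smooth_on_frechet_derivative[OF assms(2)] assms(4)])
  have general: "frechet_derivative (\<lambda>y. ?D y (u y)) (at x) h =
      (\<Sum>b\<in>Basis. (u x \<bullet> b) *\<^sub>R frechet_derivative (\<lambda>y. ?D y b) (at x) h
        + (frechet_derivative u (at x) h \<bullet> b) *\<^sub>R ?D x b)"
    if u: "smooth_on S u" for u
  proof -
    have du: "(u has_derivative frechet_derivative u (at x)) (at x)"
      by (rule smooth_on_has_derivative[OF u assms(4)])
    have "((\<lambda>y. \<Sum>b\<in>Basis. (u y \<bullet> b) *\<^sub>R ?D y b) has_derivative
        (\<lambda>h. \<Sum>b\<in>Basis. (u x \<bullet> b) *\<^sub>R frechet_derivative (\<lambda>y. ?D y b) (at x) h
        + (frechet_derivative u (at x) h \<bullet> b) *\<^sub>R ?D x b)) (at x)"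
      by (intro has_derivative_sum has_derivative_scaleR db has_derivative_inner_left du)
    then have "((\<lambda>y. ?D y (u y)) has_derivative
        (\<lambda>h. \<Sum>b\<in>Basis. (u x \<bullet> b) *\<^sub>R frechet_derivative (\<lambda>y. ?D y b) (at x) h
        + (frechet_derivative u (at x) h \<bullet> b) *\<^sub>R ?D x b)) (at x)"
      by (rule has_derivative_transform_within_open[OF _ assms(1,4)])
        (rule linear_eq_sum_Basis[OF lin, symmetric])
    from frechet_derivative_at[OF this] show ?thesis by (metis (no_types, lifting))
  qed
  show ?thesis
    using general[OF assms(3)] general[OF smooth_on_const, of "w x"]
      linear_eq_sum_Basis[OF lin[OF assms(4)], of "frechet_derivative w (at x) h"]
    by (simp add: sum.distrib)
qed

text \<open>The mean value theorem applied twice to the second difference over a parallelogram.  The left-hand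
  side of the equation is symmetric in \<open>u\<close> and \<open>v\<close>, which yields the symmetry of second
  derivatives when \<open>t\<close> tends to \<open>0\<close>.\<close>

lemma second_difference_mvt:
  fixes f :: "'a::euclidean_space \<Rightarrow> real"
  assumes "open S" "smooth_on S f" and t: "0 < t"
    and inS: "\<And>a b. \<lbrakk>0 \<le> a; a \<le> t; 0 \<le> b; b \<le> t\<rbrakk> \<Longrightarrow> x + a *\<^sub>R u + b *\<^sub>R v \<in> S"
  obtains a b where "0 \<le> a" "a \<le> t" "0 \<le> b" "b \<le> t"
    "f (x + t *\<^sub>R u + t *\<^sub>R v) - f (x + t *\<^sub>R u) - f (x + t *\<^sub>R v) + f x
      = t\<^sup>2 * frechet_derivative (\<lambda>y. frechet_derivative f (at y) u) (at (x + a *\<^sub>R u + b *\<^sub>R v)) v"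
proof -
  have deriv: "((\<lambda>s. h (z + s *\<^sub>R w)) has_real_derivative frechet_derivative h (at (z + s *\<^sub>R w)) w) (at s)"
    if h: "smooth_on S h" and "z + s *\<^sub>R w \<in> S" for h :: "'a \<Rightarrow> real" and z w s
  proof -
    have 1: "((\<lambda>s. z + s *\<^sub>R w) has_derivative (\<lambda>k. k *\<^sub>R w)) (at s)"
      by (auto intro!: derivative_eq_intros)
    have 2: "((\<lambda>s. h (z + s *\<^sub>R w)) has_derivative
        (\<lambda>k. frechet_derivative h (at (z + s *\<^sub>R w)) (k *\<^sub>R w))) (at s)"
      using has_derivative_compose[OF 1 smooth_on_has_derivative[OF that]] .
    have "linear (frechet_derivative h (at (z + s *\<^sub>R w)))"
      using that by (auto intro: linear_frechet_derivative smooth_on_differentiable)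
    with 2 show ?thesis
      by (simp add: has_field_derivative_def linear_scale mult.commute[of _ "frechet_derivative _ _ _"])
  qed
  let ?D = "\<lambda>y. frechet_derivative f (at y) u"
  have "\<exists>a. 0 < a \<and> a < t \<and>
      (f (x + t *\<^sub>R v + t *\<^sub>R u) - f (x + t *\<^sub>R u)) - (f (x + t *\<^sub>R v + 0 *\<^sub>R u) - f (x + 0 *\<^sub>R u))
      = (t - 0) * (?D (x + t *\<^sub>R v + a *\<^sub>R u) - ?D (x + a *\<^sub>R u))"
  proof (rule MVT2[OF t])
    fix a assume a: "0 \<le> a" "a \<le> t"
    show "((\<lambda>a. f (x + t *\<^sub>R v + a *\<^sub>R u) - f (x + a *\<^sub>R u)) has_real_derivative
        ?D (x + t *\<^sub>R v + a *\<^sub>R u) - ?D (x + a *\<^sub>R u)) (at a)"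
      using inS[OF a, of t] inS[OF a, of 0] t
      by (intro DERIV_diff deriv assms) (auto simp: add_ac)
  qed
  then obtain a where a: "0 < a" "a < t"
    "(f (x + t *\<^sub>R v + t *\<^sub>R u) - f (x + t *\<^sub>R u)) - (f (x + t *\<^sub>R v) - f x)
      = t * (?D (x + t *\<^sub>R v + a *\<^sub>R u) - ?D (x + a *\<^sub>R u))" by auto
  have "\<exists>b. 0 < b \<and> b < t \<and> ?D (x + a *\<^sub>R u + t *\<^sub>R v) - ?D (x + a *\<^sub>R u + 0 *\<^sub>R v)
      = (t - 0) * frechet_derivative ?D (at (x + a *\<^sub>R u + b *\<^sub>R v)) v"
    using a inS by (intro MVT2[OF t] deriv smooth_on_frechet_derivative assms) auto
  then obtain b where b: "0 < b" "b < t" "?D (x + a *\<^sub>R u + t *\<^sub>R v) - ?D (x + a *\<^sub>R u)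
      = t * frechet_derivative ?D (at (x + a *\<^sub>R u + b *\<^sub>R v)) v" by auto
  have "f (x + t *\<^sub>R u + t *\<^sub>R v) - f (x + t *\<^sub>R u) - f (x + t *\<^sub>R v) + f x
      = t * (?D (x + a *\<^sub>R u + t *\<^sub>R v) - ?D (x + a *\<^sub>R u))"
    using a(3) by (simp add: add_ac algebra_simps)
  also have "\<dots> = t\<^sup>2 * frechet_derivative ?D (at (x + a *\<^sub>R u + b *\<^sub>R v)) v"
    unfolding b(3) by (simp add: power2_eq_square)
  finally show ?thesis using that[of a b] a b by auto
qed

lemma mixed_derivatives_commute:
  fixes f :: "'a::euclidean_space \<Rightarrow> real"
  assumes "open S" "smooth_on S f" "x \<in> S"
  shows "frechet_derivative (\<lambda>y. frechet_derivative f (at y) u) (at x) v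
    = frechet_derivative (\<lambda>y. frechet_derivative f (at y) v) (at x) u" (is "?A x = ?B x")
proof -
  define A where "A = ?A"
  define B where "B = ?B"
  have cont: "isCont A x" "isCont B x"
    using smooth_on_continuous[OF smooth_on_frechet_derivative[OF smooth_on_frechet_derivative[OF assms(2)]]]
      assms(1,3) unfolding A_def B_def by (auto simp: continuous_on_eq_continuous_at)
  have "\<bar>A x - B x\<bar> \<le> e" if e: "e > 0" for e
  proof -
    obtain r where r: "r > 0" "ball x r \<subseteq> S" using assms(1,3) openE by blast
    obtain d1 where d1: "d1 > 0" "\<And>y. dist y x < d1 \<Longrightarrow> \<bar>A y - A x\<bar> < e/2"
      using cont(1)[unfolded continuous_at_eps_delta dist_real_def, rule_format,
          OF half_gt_zero[OF e]] by blast
    obtain d2 where d2: "d2 > 0" "\<And>y. dist y x < d2 \<Longrightarrow> \<bar>B y - B x\<bar> < e/2"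
      using cont(2)[unfolded continuous_at_eps_delta dist_real_def, rule_format,
          OF half_gt_zero[OF e]] by blast
    define d where "d = Min {r, d1, d2}"
    \<comment> \<open>Small enough for the whole parallelogram to lie in the ball of radius \<open>d\<close>; the summand 1
      covers the case that \<open>u\<close> and \<open>v\<close> vanish.\<close>
    define t where "t = d / (2 * (norm u + norm v + 1))"
    have d: "d > 0" "d \<le> r" "d \<le> d1" "d \<le> d2" using r d1 d2 by (auto simp: d_def)
    have n: "norm u + norm v + 1 > 0" by (smt (verit) norm_ge_zero)
    have t: "t > 0" using d n by (simp add: t_def)
    have near: "dist (x + a *\<^sub>R u' + b *\<^sub>R v') x < d"
      if "0 \<le> a" "a \<le> t" "0 \<le> b" "b \<le> t" "norm u' + norm v' = norm u + norm v" for a b u' v'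
    proof -
      have "norm (a *\<^sub>R u' + b *\<^sub>R v') \<le> \<bar>a\<bar> * norm u' + \<bar>b\<bar> * norm v'"
        by (metis norm_scaleR norm_triangle_ineq)
      also have "\<dots> \<le> t * norm u' + t * norm v'"
        using that by (intro add_mono mult_right_mono) auto
      also have "\<dots> = t * (norm u + norm v)" using that by (simp add: distrib_left[symmetric])
      also have "\<dots> < t * (2 * (norm u + norm v + 1))"
        using t n by (intro mult_strict_left_mono) (auto intro: add_pos_nonneg simp: add_strict_increasing2)
      also have "\<dots> = d" using n by (simp add: t_def)
      finally show ?thesis by (simp add: dist_norm add.assoc)
    qed
    have inS: "x + a *\<^sub>R u' + b *\<^sub>R v' \<in> S"
      if "0 \<le> a" "a \<le> t" "0 \<le> b" "b \<le> t" "norm u' + norm v' = norm u + norm v" for a b u' v'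
      using near[OF that] d r by (auto simp: dist_commute subset_iff)
    obtain a b where ab: "0 \<le> a" "a \<le> t" "0 \<le> b" "b \<le> t"
      "f (x + t *\<^sub>R u + t *\<^sub>R v) - f (x + t *\<^sub>R u) - f (x + t *\<^sub>R v) + f x
        = t\<^sup>2 * A (x + a *\<^sub>R u + b *\<^sub>R v)"
      using second_difference_mvt[OF assms(1,2) t inS[of _ _ u v]] unfolding A_def by auto
    obtain a' b' where ab': "0 \<le> a'" "a' \<le> t" "0 \<le> b'" "b' \<le> t"
      "f (x + t *\<^sub>R v + t *\<^sub>R u) - f (x + t *\<^sub>R v) - f (x + t *\<^sub>R u) + f x
        = t\<^sup>2 * B (x + a' *\<^sub>R v + b' *\<^sub>R u)"
      using second_difference_mvt[OF assms(1,2) t inS[of _ _ v u]] unfolding B_def by auto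
    have "t\<^sup>2 * A (x + a *\<^sub>R u + b *\<^sub>R v) = t\<^sup>2 * B (x + a' *\<^sub>R v + b' *\<^sub>R u)"
      unfolding ab(5)[symmetric] ab'(5)[symmetric] by (simp add: algebra_simps)
    then have eq: "A (x + a *\<^sub>R u + b *\<^sub>R v) = B (x + a' *\<^sub>R v + b' *\<^sub>R u)" using t by simp
    have "\<bar>A (x + a *\<^sub>R u + b *\<^sub>R v) - A x\<bar> < e/2"
      using near[OF ab(1-4), of u v] d by (intro d1(2)) linarith
    moreover have "\<bar>B (x + a' *\<^sub>R v + b' *\<^sub>R u) - B x\<bar> < e/2"
      using near[OF ab'(1-4), of v u] d by (intro d2(2)) linarith
    ultimately show ?thesis unfolding eq by linarith
  qed
  then have "A x = B x" using field_le_epsilon[of "\<bar>A x - B x\<bar>" 0] by simp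
  then show ?thesis by (simp add: A_def B_def)
qed

section \<open>Charts and their transition maps\<close>

text \<open>The change of components of tangent vectors at \<open>q\<close> from the chart \<open>c\<close> to the chart \<open>d\<close>.\<close>

abbreviation jac ::
  "('a, 'm::finite) chart \<Rightarrow> ('a, 'm) chart \<Rightarrow> 'a \<Rightarrow> real ^ 'm \<Rightarrow> real ^ 'm"
  where "jac c d q \<equiv> frechet_derivative (transition c d) (at (snd c q))"

context smooth_manifold
begin

lemma chart_subset: "c \<in> atlas M \<Longrightarrow> fst c \<subseteq> pts M"
  using charts[of c] openin_subset unfolding is_chart_def by blast

lemma openin_chart: "c \<in> atlas M \<Longrightarrow> openin (mtop M) (fst c)"
  using charts[of c] unfolding is_chart_def by blast

lemma openin_Int_chart: "openin (mtop M) U \<Longrightarrow> c \<in> atlas M \<Longrightarrow> openin (mtop M) (U \<inter> fst c)"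
  using openin_chart by blast

lemma chart_homeomorphic:
  "c \<in> atlas M \<Longrightarrow>
    homeomorphic_map (subtopology (mtop M) (fst c)) (top_of_set (snd c ` fst c)) (snd c)"
  using charts[of c] unfolding is_chart_def by blast

lemma inj_on_chart: "c \<in> atlas M \<Longrightarrow> inj_on (snd c) (fst c)"
  using homeomorphic_imp_injective_map[OF chart_homeomorphic] chart_subset
  by (fastforce simp: Int_absorb1)

lemma inv_chart_chart [simp]: "c \<in> atlas M \<Longrightarrow> q \<in> fst c \<Longrightarrow> inv_chart c (snd c q) = q"
  by (simp add: inv_chart_def inj_on_chart)

lemma open_chart_image:
  assumes "c \<in> atlas M" "openin (mtop M) U"
  shows "open (snd c ` (U \<inter> fst c))"
proof -
  have "openin (subtopology (mtop M) (fst c)) (U \<inter> fst c)"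
    using assms(2) by (auto simp: openin_subtopology)
  then have "openin (top_of_set (snd c ` fst c)) (snd c ` (U \<inter> fst c))"
    using homeomorphic_imp_open_map[OF chart_homeomorphic[OF assms(1)]]
    unfolding open_map_def by blast
  moreover have "open (snd c ` fst c)" using charts[OF assms(1)] unfolding is_chart_def by blast
  ultimately show ?thesis by (metis openin_open_trans)
qed

lemma openin_chart_vimage:
  assumes "c \<in> atlas M" "open V"
  shows "openin (mtop M) {q \<in> fst c. snd c q \<in> V}"
proof -
  have "openin (top_of_set (snd c ` fst c)) (snd c ` fst c \<inter> V)" using assms(2) by blast
  then have "openin (subtopology (mtop M) (fst c))
      {q \<in> topspace (subtopology (mtop M) (fst c)). snd c q \<in> snd c ` fst c \<inter> V}"
    by (rule openin_continuous_map_preimage[OF homeomorphic_imp_continuous_map[OF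
          chart_homeomorphic[OF assms(1)]]])
  moreover have "{q \<in> topspace (subtopology (mtop M) (fst c)). snd c q \<in> snd c ` fst c \<inter> V}
      = {q \<in> fst c. snd c q \<in> V}"
    using chart_subset[OF assms(1)] by auto
  ultimately show ?thesis
    using openin_trans_full[OF _ openin_chart[OF assms(1)]] by metis
qed

lemma chart_at_atlas: "p \<in> pts M \<Longrightarrow> chart_at M p \<in> atlas M"
  and in_chart_at: "p \<in> pts M \<Longrightarrow> p \<in> fst (chart_at M p)"
proof -
  assume "p \<in> pts M"
  then have "\<exists>c. c \<in> atlas M \<and> p \<in> fst c" using covering by blast
  then have "chart_at M p \<in> atlas M \<and> p \<in> fst (chart_at M p)"
    unfolding chart_at_def by (rule someI_ex)
  then show "chart_at M p \<in> atlas M" "p \<in> fst (chart_at M p)" by auto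
qed

lemma transition_chart: "c \<in> atlas M \<Longrightarrow> q \<in> fst c \<Longrightarrow> transition c d (snd c q) = snd d q"
  by (simp add: transition_def)

lemma transition_has_derivative:
  assumes "c \<in> atlas M" "d \<in> atlas M" "q \<in> fst c" "q \<in> fst d"
  shows "(transition c d has_derivative jac c d q) (at (snd c q))"
  using smooth_on_has_derivative[OF compatible[OF assms(1,2)]] assms by auto

lemma linear_jac:
  "\<lbrakk>c \<in> atlas M; d \<in> atlas M; q \<in> fst c; q \<in> fst d\<rbrakk> \<Longrightarrow> linear (jac c d q)"
  using transition_has_derivative has_derivative_linear by blast

lemma jac_jac:
  assumes "c \<in> atlas M" "d \<in> atlas M" "e \<in> atlas M" "q \<in> fst c" "q \<in> fst d" "q \<in> fst e"
  shows "jac d e q (jac c d q v) = jac c e q v"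
proof -
  have "(transition d e has_derivative jac d e q) (at (transition c d (snd c q)))"
    using transition_has_derivative assms by (simp add: transition_chart)
  with transition_has_derivative[OF assms(1,2,4,5)]
  have "((\<lambda>x. transition d e (transition c d x)) has_derivative (\<lambda>v. jac d e q (jac c d q v)))
      (at (snd c q))"
    by (rule has_derivative_compose)
  then have "(transition c e has_derivative (\<lambda>v. jac d e q (jac c d q v))) (at (snd c q))"
  proof (rule has_derivative_transform_within_open)
    show "open (snd c ` (fst d \<inter> fst c))" using assms open_chart_image openin_chart by blast
    show "snd c q \<in> snd c ` (fst d \<inter> fst c)" using assms by blast
    show "transition d e (transition c d x) = transition c e x"
      if "x \<in> snd c ` (fst d \<inter> fst c)" for x
      using that assms by (auto simp: transition_def)
  qed
  from frechet_derivative_at[OF this] show ?thesis by metis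
qed

lemma jac_self:
  assumes "c \<in> atlas M" "q \<in> fst c"
  shows "jac c c q v = v"
proof -
  have "((\<lambda>x. x) has_derivative (\<lambda>v. v)) (at (snd c q))" by (rule has_derivative_ident)
  then have "(transition c c has_derivative (\<lambda>v. v)) (at (snd c q))"
    by (rule has_derivative_transform_within_open[OF _ open_chart_image[OF assms(1) openin_chart[OF assms(1)]]])
      (use assms in \<open>auto simp: transition_def\<close>)
  from frechet_derivative_at[OF this] show ?thesis by metis
qed

lemma linear_dchart:
  assumes "c \<in> atlas M" "q \<in> fst c" shows "linear (dchart M c q)"
proof -
  have "q \<in> pts M" using assms chart_subset by blast
  then have "linear (jac (chart_at M q) c q)"
    using assms chart_at_atlas in_chart_at by (intro linear_jac) auto
  then show ?thesis by (simp add: dchart_def[abs_def])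
qed

lemma linear_const_field:
  assumes "c \<in> atlas M" "q \<in> fst c" shows "linear (\<lambda>v. const_field M c v q)"
proof -
  have "q \<in> pts M" using assms chart_subset by blast
  then have "linear (jac c (chart_at M q) q)"
    using assms chart_at_atlas in_chart_at by (intro linear_jac) auto
  then show ?thesis by (simp add: const_field_def)
qed

lemma dchart_const_field:
  assumes "c \<in> atlas M" "d \<in> atlas M" "q \<in> fst c" "q \<in> fst d"
  shows "dchart M d q (const_field M c v q) = jac c d q v"
proof -
  have "q \<in> pts M" using assms chart_subset by blast
  then show ?thesis
    unfolding dchart_def const_field_def
    using assms chart_at_atlas in_chart_at by (intro jac_jac) auto
qed

lemma const_field_dchart:
  assumes "c \<in> atlas M" "q \<in> fst c"
  shows "const_field M c (dchart M c q v) q = v"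
proof -
  have "q \<in> pts M" using assms chart_subset by blast
  then show ?thesis
    unfolding dchart_def const_field_def
    using assms chart_at_atlas in_chart_at by (simp add: jac_jac jac_self)
qed

lemma dchart_chart_at: "p \<in> pts M \<Longrightarrow> dchart M (chart_at M p) p v = v"
  by (simp add: dchart_def jac_self chart_at_atlas in_chart_at)

lemma const_field_chart_at: "p \<in> pts M \<Longrightarrow> const_field M (chart_at M p) v p = v"
  by (simp add: const_field_def jac_self chart_at_atlas in_chart_at)

section \<open>Smooth functions and vector fields\<close>

lemma smooth_fun_subset: "smooth_fun M U f \<Longrightarrow> V \<subseteq> U \<Longrightarrow> smooth_fun M V f"
  unfolding smooth_fun_def by (meson Int_mono image_mono order_refl smooth_on_subset)

lemma smooth_fun_cong:
  assumes "openin (mtop M) U" "\<And>q. q \<in> U \<Longrightarrow> f q = f' q" "smooth_fun M U f"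
  shows "smooth_fun M U f'"
  unfolding smooth_fun_def
proof
  fix c assume c: "c \<in> atlas M"
  show "smooth_on (snd c ` (U \<inter> fst c)) (f' \<circ> inv_chart c)"
  proof (rule smooth_on_cong[OF open_chart_image[OF c assms(1)]])
    show "smooth_on (snd c ` (U \<inter> fst c)) (f \<circ> inv_chart c)"
      using assms(3) c by (simp add: smooth_fun_def)
  qed (use assms(2) c in auto)
qed

lemma smooth_fun_const: "smooth_fun M U (\<lambda>_. k)"
  by (simp add: smooth_fun_def o_def smooth_on_const)

lemma smooth_fun_add:
  "\<lbrakk>openin (mtop M) U; smooth_fun M U f; smooth_fun M U h\<rbrakk> \<Longrightarrow> smooth_fun M U (\<lambda>q. f q + h q)"
  by (simp add: smooth_fun_def o_def smooth_on_add open_chart_image)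

lemma smooth_fun_mult:
  "\<lbrakk>openin (mtop M) U; smooth_fun M U f; smooth_fun M U h\<rbrakk> \<Longrightarrow> smooth_fun M U (\<lambda>q. f q * h q)"
  by (simp add: smooth_fun_def o_def smooth_on_mult open_chart_image)

lemma smooth_fun_powr:
  "\<lbrakk>openin (mtop M) U; smooth_fun M U f; \<And>q. q \<in> U \<Longrightarrow> f q > 0\<rbrakk> \<Longrightarrow> smooth_fun M U (\<lambda>q. f q powr a)"
  unfolding smooth_fun_def o_def
proof
  fix c assume c: "c \<in> atlas M" and U: "openin (mtop M) U" and pos: "\<And>q. q \<in> U \<Longrightarrow> f q > 0"
    and f: "\<forall>c\<in>atlas M. smooth_on (snd c ` (U \<inter> fst c)) (\<lambda>x. f (inv_chart c x))"
  show "smooth_on (snd c ` (U \<inter> fst c)) (\<lambda>x. f (inv_chart c x) powr a)"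
    by (rule smooth_on_powr[OF open_chart_image[OF c U]]) (use f c pos in auto)
qed

text \<open>Smooth functions are continuous for the manifold topology.\<close>

lemma smooth_fun_openin_pos:
  assumes "openin (mtop M) U" "smooth_fun M U f" "p \<in> U" "f p > 0"
  obtains V where "openin (mtop M) V" "p \<in> V" "V \<subseteq> U" "\<And>q. q \<in> V \<Longrightarrow> f q > 0"
proof -
  define c where "c = chart_at M p"
  have "p \<in> pts M" using assms openin_subset by blast
  then have c: "c \<in> atlas M" "p \<in> fst c" by (auto simp: c_def chart_at_atlas in_chart_at)
  let ?S = "snd c ` (U \<inter> fst c)"
  have "continuous_on ?S (f \<circ> inv_chart c)"
    using assms(2) c unfolding smooth_fun_def by (blast intro: smooth_on_continuous)
  moreover have "open ?S" by (rule open_chart_image[OF c(1) assms(1)])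
  ultimately have "open (?S \<inter> (f \<circ> inv_chart c) -` {0<..})"
    by (intro continuous_open_preimage open_greaterThan)
  from openin_chart_vimage[OF c(1) this]
  have "openin (mtop M) {q \<in> fst c. snd c q \<in> ?S \<inter> (f \<circ> inv_chart c) -` {0<..}}" .
  moreover have "{q \<in> fst c. snd c q \<in> ?S \<inter> (f \<circ> inv_chart c) -` {0<..}} = {q \<in> U \<inter> fst c. f q > 0}"
    using c(1) by (auto simp: inj_on_eq_iff[OF inj_on_chart[OF c(1)]])
  ultimately have "openin (mtop M) {q \<in> U \<inter> fst c. f q > 0}" by metis
  then show ?thesis using that[of "{q \<in> U \<inter> fst c. f q > 0}"] assms c by blast
qed

lemma smooth_fun_coordinate:
  assumes "c \<in> atlas M"
  shows "smooth_fun M (fst c) (\<lambda>q. snd c q $ i)"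
  unfolding smooth_fun_def
proof
  fix d assume d: "d \<in> atlas M"
  have "smooth_on (snd d ` (fst d \<inter> fst c)) (\<lambda>x. transition d c x \<bullet> axis i 1)"
    using assms d open_chart_image[OF d openin_chart[OF assms]]
    by (intro smooth_on_inner smooth_on_const compatible) (auto simp: Int_commute)
  then show "smooth_on (snd d ` (fst c \<inter> fst d)) ((\<lambda>q. snd c q $ i) \<circ> inv_chart d)"
    by (simp add: Int_commute inner_axis transition_def o_def)
qed

lemma smooth_vfield_subset: "smooth_vfield M U X \<Longrightarrow> V \<subseteq> U \<Longrightarrow> smooth_vfield M V X"
  unfolding smooth_vfield_def by (meson Int_mono image_mono order_refl smooth_on_subset)

lemma smooth_vfield_cong:
  assumes "openin (mtop M) U" "\<And>q. q \<in> U \<Longrightarrow> X q = X' q" "smooth_vfield M U X"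
  shows "smooth_vfield M U X'"
  unfolding smooth_vfield_def
proof
  fix c assume c: "c \<in> atlas M"
  show "smooth_on (snd c ` (U \<inter> fst c)) (local_rep M c X')"
  proof (rule smooth_on_cong[OF open_chart_image[OF c assms(1)]])
    show "smooth_on (snd c ` (U \<inter> fst c)) (local_rep M c X)"
      using assms(3) c by (simp add: smooth_vfield_def)
  qed (use assms(2) c in \<open>auto simp: local_rep_def\<close>)
qed

lemma smooth_vfield_scale:
  assumes "openin (mtop M) U" "smooth_fun M U f" "smooth_vfield M U X"
  shows "smooth_vfield M U (\<lambda>q. f q *\<^sub>R X q)"
  unfolding smooth_vfield_def
proof
  fix c assume c: "c \<in> atlas M"
  note op = open_chart_image[OF c assms(1)]
  have "smooth_on (snd c ` (U \<inter> fst c)) (\<lambda>x. (f \<circ> inv_chart c) x *\<^sub>R local_rep M c X x)"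
    using assms c unfolding smooth_fun_def smooth_vfield_def by (intro smooth_on_scaleR op) blast+
  then show "smooth_on (snd c ` (U \<inter> fst c)) (local_rep M c (\<lambda>q. f q *\<^sub>R X q))"
    by (rule smooth_on_cong[OF op, rotated])
      (use c in \<open>auto simp: local_rep_def linear_scale[OF linear_dchart]\<close>)
qed

lemma smooth_vfield_add:
  assumes "openin (mtop M) U" "smooth_vfield M U X" "smooth_vfield M U Y"
  shows "smooth_vfield M U (\<lambda>q. X q + Y q)"
  unfolding smooth_vfield_def
proof
  fix c assume c: "c \<in> atlas M"
  note op = open_chart_image[OF c assms(1)]
  have "smooth_on (snd c ` (U \<inter> fst c)) (\<lambda>x. local_rep M c X x + local_rep M c Y x)"
    using assms c by (intro smooth_on_add op) (auto simp: smooth_vfield_def)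
  then show "smooth_on (snd c ` (U \<inter> fst c)) (local_rep M c (\<lambda>q. X q + Y q))"
    by (rule smooth_on_cong[OF op, rotated])
      (use c in \<open>auto simp: local_rep_def linear_add[OF linear_dchart]\<close>)
qed

lemma smooth_vfield_zero:
  assumes "openin (mtop M) U"
  shows "smooth_vfield M U (\<lambda>_. 0)"
  unfolding smooth_vfield_def
proof
  fix c assume c: "c \<in> atlas M"
  note op = open_chart_image[OF c assms(1)]
  show "smooth_on (snd c ` (U \<inter> fst c)) (local_rep M c (\<lambda>_. 0))"
    by (rule smooth_on_cong[OF op _ smooth_on_const[of _ 0]])
      (use c in \<open>auto simp: local_rep_def linear_0[OF linear_dchart]\<close>)
qed

lemma smooth_vfield_diff:
  assumes "openin (mtop M) U" "smooth_vfield M U X" "smooth_vfield M U Y"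
  shows "smooth_vfield M U (\<lambda>q. X q - Y q)"
  using smooth_vfield_add[OF assms(1,2) smooth_vfield_scale[OF assms(1) smooth_fun_const[of U "-1"] assms(3)]]
  by simp

lemma smooth_vfield_sum:
  assumes "openin (mtop M) U" "\<And>i. i \<in> I \<Longrightarrow> smooth_vfield M U (X i)"
  shows "smooth_vfield M U (\<lambda>q. \<Sum>i\<in>I. X i q)"
  using assms(2)
  by (induction I rule: infinite_finite_induct)
    (auto intro: smooth_vfield_zero smooth_vfield_add assms(1))

text \<open>In another chart \<open>d\<close> the components of the field are the derivative of the transition map from \<open>c\<close>
  to \<open>d\<close> in the direction \<open>v\<close>, evaluated at the point transported to the chart \<open>c\<close>.\<close>

lemma smooth_const_field:
  assumes c: "c \<in> atlas M"
  shows "smooth_vfield M (fst c) (const_field M c v)"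
  unfolding smooth_vfield_def
proof
  fix d assume d: "d \<in> atlas M"
  let ?S = "snd d ` (fst c \<inter> fst d)"
  have op: "open ?S" by (rule open_chart_image[OF d openin_chart[OF c]])
  have op': "open (snd c ` (fst c \<inter> fst d))"
    using open_chart_image[OF c openin_chart[OF d]] by (simp add: Int_commute)
  have "smooth_on ?S (\<lambda>y. frechet_derivative (transition c d) (at (transition d c y)) v)"
  proof (rule smooth_on_compose[OF op op', where g = "transition d c"])
    show "transition d c ` ?S \<subseteq> snd c ` (fst c \<inter> fst d)"
      using c d by (auto simp: transition_chart)
    show "smooth_on ?S (transition d c)" using compatible[OF d c] by (simp add: Int_commute)
    show "smooth_on (snd c ` (fst c \<inter> fst d)) (\<lambda>x. frechet_derivative (transition c d) (at x) v)"
      by (intro smooth_on_frechet_derivative compatible c d)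
  qed
  then show "smooth_on ?S (local_rep M d (const_field M c v))"
    by (rule smooth_on_cong[OF op, rotated])
      (use c d in \<open>auto simp: local_rep_def transition_chart dchart_const_field\<close>)
qed

section \<open>Directional derivatives and brackets\<close>

lemma smooth_fun_differentiable:
  "\<lbrakk>smooth_fun M U f; c \<in> atlas M; q \<in> U; q \<in> fst c\<rbrakk> \<Longrightarrow> (f \<circ> inv_chart c) differentiable (at (snd c q))"
  unfolding smooth_fun_def by (blast intro: smooth_on_differentiable)

text \<open>Directional derivatives are defined in the preferred chart of each point, which may change
  arbitrarily from point to point.  Differentiating them once more requires a fixed chart.\<close>

lemma dirderiv_chart:
  assumes "openin (mtop M) U" "smooth_fun M U f" "c \<in> atlas M" "q \<in> U" "q \<in> fst c"
  shows "dirderiv M X f q = frechet_derivative (f \<circ> inv_chart c) (at (snd c q)) (dchart M c q (X q))"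
proof -
  define d where "d = chart_at M q"
  have "q \<in> pts M" using assms chart_subset by blast
  then have d: "d \<in> atlas M" "q \<in> fst d" by (auto simp: d_def chart_at_atlas in_chart_at)
  have "((f \<circ> inv_chart c) has_derivative frechet_derivative (f \<circ> inv_chart c) (at (snd c q)))
      (at (transition d c (snd d q)))"
    using smooth_fun_differentiable[OF assms(2,3,4,5)] d
    by (simp add: frechet_derivative_works[symmetric] transition_chart)
  with transition_has_derivative[OF d(1) assms(3) d(2) assms(5)]
  have "((\<lambda>x. (f \<circ> inv_chart c) (transition d c x)) has_derivative
      (\<lambda>v. frechet_derivative (f \<circ> inv_chart c) (at (snd c q)) (jac d c q v))) (at (snd d q))"
    by (rule has_derivative_compose)
  then have "((f \<circ> inv_chart d) has_derivative
      (\<lambda>v. frechet_derivative (f \<circ> inv_chart c) (at (snd c q)) (jac d c q v))) (at (snd d q))"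
  proof (rule has_derivative_transform_within_open)
    show "open (snd d ` (fst c \<inter> fst d))" using assms(3) d open_chart_image openin_chart by blast
    show "snd d q \<in> snd d ` (fst c \<inter> fst d)" using assms d by blast
    show "(f \<circ> inv_chart c) (transition d c x) = (f \<circ> inv_chart d) x"
      if "x \<in> snd d ` (fst c \<inter> fst d)" for x
      using that assms(3) d by (auto simp: transition_def)
  qed
  from frechet_derivative_at[OF this] show ?thesis
    unfolding dirderiv_def dchart_def d_def by metis
qed

lemma dirderiv_cong:
  assumes "openin (mtop M) U" "p \<in> U" "smooth_fun M U f" "\<And>q. q \<in> U \<Longrightarrow> f q = f' q" "X p = X' p"
  shows "dirderiv M X f p = dirderiv M X' f' p"
proof -
  define c where "c = chart_at M p"
  have "p \<in> pts M" using assms openin_subset by blast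
  then have c: "c \<in> atlas M" "p \<in> fst c" by (auto simp: c_def chart_at_atlas in_chart_at)
  have "frechet_derivative (f \<circ> inv_chart c) (at (snd c p))
      = frechet_derivative (f' \<circ> inv_chart c) (at (snd c p))"
    by (rule frechet_derivative_transform_within_open[OF
          smooth_fun_differentiable[OF assms(3) c(1) assms(2) c(2)] open_chart_image[OF c(1) assms(1)]])
      (use assms c in auto)
  then show ?thesis using assms(5) by (simp add: dirderiv_def c_def)
qed

lemma dirderiv_const: "dirderiv M X (\<lambda>_. k) p = 0"
  by (simp add: dirderiv_def o_def)

lemma dirderiv_locally_const:
  assumes "openin (mtop M) U" "p \<in> U" "\<And>q. q \<in> U \<Longrightarrow> f q = k"
  shows "dirderiv M X f p = 0"
  using dirderiv_cong[OF assms(1,2) smooth_fun_const[of U k], of f X X] assms(3) dirderiv_const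
  by metis

lemma dirderiv_sum:
  assumes "openin (mtop M) U" "p \<in> U" "\<And>i. i \<in> I \<Longrightarrow> smooth_fun M U (f i)"
  shows "dirderiv M X (\<lambda>q. \<Sum>i\<in>I. k i * f i q) p = (\<Sum>i\<in>I. k i * dirderiv M X (f i) p)"
proof -
  define c where "c = chart_at M p"
  have "p \<in> pts M" using assms openin_subset by blast
  then have c: "c \<in> atlas M" "p \<in> fst c" by (auto simp: c_def chart_at_atlas in_chart_at)
  have "((\<lambda>x. \<Sum>i\<in>I. k i * (f i \<circ> inv_chart c) x) has_derivative
      (\<lambda>v. \<Sum>i\<in>I. k i * frechet_derivative (f i \<circ> inv_chart c) (at (snd c p)) v)) (at (snd c p))"
    using smooth_fun_differentiable[OF assms(3) c(1) assms(2) c(2)]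
    by (intro has_derivative_sum has_derivative_mult_right)
      (simp only: frechet_derivative_works[symmetric])
  from fun_cong[OF frechet_derivative_at[OF this]] show ?thesis
    by (simp add: dirderiv_def c_def[symmetric] o_def)
qed

lemma dirderiv_add:
  assumes "openin (mtop M) U" "p \<in> U" "smooth_fun M U f" "smooth_fun M U h"
  shows "dirderiv M X (\<lambda>q. f q + h q) p = dirderiv M X f p + dirderiv M X h p"
  using dirderiv_sum[OF assms(1,2), of "UNIV :: bool set" "\<lambda>b. if b then f else h" X "\<lambda>_. 1"] assms(3,4)
  by (simp add: UNIV_bool add.commute)

text \<open>In a chart, \<open>X(Y f)\<close> is the sum of \<open>df\<close> applied to the derivative of \<open>Y\<close> along \<open>X\<close> and of the second
  derivative of \<open>f\<close>; the latter is symmetric and cancels in the commutator.\<close>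

lemma dirderiv_lie_bracket:
  assumes U: "openin (mtop M) U" "p \<in> U" and f: "smooth_fun M U f"
    and X: "smooth_vfield M U X" and Y: "smooth_vfield M U Y"
  shows "dirderiv M (lie_bracket M X Y) f p
    = dirderiv M X (dirderiv M Y f) p - dirderiv M Y (dirderiv M X f) p"
proof -
  define c where "c = chart_at M p"
  define x where "x = snd c p"
  define F where "F = f \<circ> inv_chart c"
  let ?S = "snd c ` (U \<inter> fst c)"
  have p: "p \<in> pts M" using U openin_subset by blast
  then have c: "c \<in> atlas M" "p \<in> fst c" by (auto simp: c_def chart_at_atlas in_chart_at)
  have S: "open ?S" "x \<in> ?S" using open_chart_image[OF c(1) U(1)] U c by (auto simp: x_def)
  have F: "smooth_on ?S F" using f c by (simp add: smooth_fun_def F_def)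
  have second: "dirderiv M V (dirderiv M W f) p =
      frechet_derivative F (at x) (frechet_derivative (local_rep M c W) (at x) (V p))
      + frechet_derivative (\<lambda>y. frechet_derivative F (at y) (W p)) (at x) (V p)"
    if W: "smooth_vfield M U W" for V W
  proof -
    let ?G = "\<lambda>y. frechet_derivative F (at y) (local_rep M c W y)"
    have W': "smooth_on ?S (local_rep M c W)" using W c by (simp add: smooth_vfield_def)
    have "frechet_derivative ?G (at x) = frechet_derivative (dirderiv M W f \<circ> inv_chart c) (at x)"
    proof (rule frechet_derivative_transform_within_open[OF _ S])
      show "?G differentiable at x"
        using smooth_on_frechet_derivative_field[OF S(1) F W'] S(2) by (rule smooth_on_differentiable)
      show "?G y = (dirderiv M W f \<circ> inv_chart c) y" if "y \<in> ?S" for y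
        using that c dirderiv_chart[OF U(1) f c(1)] by (auto simp: local_rep_def F_def)
    qed
    moreover have "local_rep M c W x = W p"
      using c p by (simp add: local_rep_def x_def dchart_chart_at c_def)
    ultimately show ?thesis
      using frechet_derivative_along_field[OF S(1) F W' S(2)]
      by (simp add: dirderiv_def c_def[symmetric] x_def[symmetric])
  qed
  have "linear (frechet_derivative F (at x))"
    using F S by (auto intro: linear_frechet_derivative smooth_on_differentiable)
  moreover have "dirderiv M (lie_bracket M X Y) f p = frechet_derivative F (at x)
      (frechet_derivative (local_rep M c Y) (at x) (X p) - frechet_derivative (local_rep M c X) (at x) (Y p))"
    by (simp add: dirderiv_def lie_bracket_def c_def F_def x_def Let_def)
  ultimately show ?thesis
    using second[OF X] second[OF Y] mixed_derivatives_commute[OF S(1) F S(2), of "X p" "Y p"]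
    by (simp add: linear_diff)
qed

text \<open>The derivatives of the coordinate functions recover a tangent vector, so that two fields can be
  compared by their action on functions.\<close>

lemma dirderiv_coordinate:
  assumes "c \<in> atlas M" "q \<in> fst c"
  shows "dirderiv M X (\<lambda>q. snd c q $ i) q = dchart M c q (X q) $ i"
proof -
  have "((\<lambda>x. x $ i) has_derivative (\<lambda>v. v $ i)) (at (snd c q))"
    by (rule bounded_linear.has_derivative[OF bounded_linear_vec_nth has_derivative_ident])
  then have "(((\<lambda>q. snd c q $ i) \<circ> inv_chart c) has_derivative (\<lambda>v. v $ i)) (at (snd c q))"
    by (rule has_derivative_transform_within_open[OF _ open_chart_image[OF assms(1) openin_chart[OF assms(1)]]])
      (use assms in auto)
  from frechet_derivative_at[OF this] show ?thesis
    using dirderiv_chart[OF openin_chart[OF assms(1)] smooth_fun_coordinate[OF assms(1)] assms(1,2,2)]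
    by metis
qed

text \<open>A field with constant components has constant derivatives on the coordinate functions, so the bracket
  of two such fields annihilates all of them.\<close>

lemma lie_bracket_const_field:
  assumes "c \<in> atlas M" "q \<in> fst c"
  shows "lie_bracket M (const_field M c u) (const_field M c v) q = 0"
proof -
  note op = openin_chart[OF assms(1)]
  note sm = smooth_const_field[OF assms(1)]
  have const: "dirderiv M (const_field M c u) (\<lambda>q. snd c q $ i) r = u $ i" if "r \<in> fst c" for u i r
    using that assms(1) by (simp add: dirderiv_coordinate dchart_const_field jac_self)
  have "dchart M c q (lie_bracket M (const_field M c u) (const_field M c v) q) $ i = 0" for i
  proof -
    have "dirderiv M (const_field M c w) (dirderiv M (const_field M c z) (\<lambda>q. snd c q $ i)) q = 0" for w z
      by (rule dirderiv_locally_const[OF op assms(2) const])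
    then show ?thesis
      using dirderiv_lie_bracket[OF op assms(2) smooth_fun_coordinate[OF assms(1), of i] sm[of u] sm[of v]]
      by (simp add: dirderiv_coordinate[OF assms])
  qed
  then have "dchart M c q (lie_bracket M (const_field M c u) (const_field M c v) q) = 0"
    by (simp add: vec_eq_iff)
  from arg_cong[OF this, of "\<lambda>w. const_field M c w q"] show ?thesis
    unfolding const_field_dchart[OF assms] linear_0[OF linear_const_field[OF assms]] .
qed

end

section \<open>Pseudo-orthonormal bases and frames\<close>

lemma bilinear_sum_scale_left:
  fixes B :: "'a::real_vector \<Rightarrow> 'b::real_vector \<Rightarrow> real"
  assumes "bilinear B"
  shows "B (\<Sum>i\<in>I. k i *\<^sub>R x i) y = (\<Sum>i\<in>I. k i * B (x i) y)"
proof -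
  have lin: "linear (\<lambda>v. B v y)" using assms by (simp add: bilinear_def)
  show ?thesis unfolding linear_sum[OF lin] linear_scale[OF lin] by simp
qed

text \<open>The coefficients of a combination of the \<open>b i\<close> are recovered by the form, so the \<open>b i\<close> are linearly
  independent; there are as many of them as the dimension.\<close>

lemma pseudo_orthonormal_expansion:
  fixes B :: "real ^ 'm \<Rightarrow> real ^ 'm \<Rightarrow> real" and b :: "'m::finite \<Rightarrow> real ^ 'm"
  assumes B: "bilinear B" and b: "\<And>i j. B (b i) (b j) = (if i = j then \<epsilon> i else 0)"
    and eps: "\<And>i. \<epsilon> i = 1 \<or> \<epsilon> i = -1"
  shows "v = (\<Sum>i\<in>UNIV. (\<epsilon> i * B v (b i)) *\<^sub>R b i)"
proof -
  have eps2: "\<epsilon> i * \<epsilon> i = 1" for i using eps[of i] by auto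
  define f where "f x = (\<Sum>i\<in>UNIV. (x $ i) *\<^sub>R b i)" for x :: "real ^ 'm"
  have coeff: "B (f x) (b j) = x $ j * \<epsilon> j" for x j
  proof -
    have "B (f x) (b j) = (\<Sum>i\<in>UNIV. x $ i * B (b i) (b j))"
      unfolding f_def by (rule bilinear_sum_scale_left[OF B])
    also have "\<dots> = (\<Sum>i\<in>UNIV. if i = j then x $ j * \<epsilon> j else 0)"
      by (rule sum.cong) (auto simp: b)
    finally show ?thesis by simp
  qed
  have lin: "linear f"
    by (rule linearI) (simp_all add: f_def sum.distrib scaleR_add_left scaleR_sum_right)
  have "inj f"
  proof (rule injI)
    fix x y assume "f x = f y"
    then have "x $ j * \<epsilon> j = y $ j * \<epsilon> j" for j using coeff by metis
    moreover have "\<epsilon> j \<noteq> 0" for j using eps[of j] by auto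
    ultimately show "x = y" by (simp add: vec_eq_iff)
  qed
  then have "surj f" by (rule linear_injective_imp_surjective[OF lin _]) simp
  then obtain x where x: "v = f x" by auto
  have "\<epsilon> i * B v (b i) = x $ i" for i
    unfolding x coeff using eps2[of i] by (metis mult.assoc mult.commute mult_1)
  then show ?thesis using x by (simp add: f_def)
qed

lemma trace_pseudo_orthonormal:
  fixes B :: "real ^ 'm \<Rightarrow> real ^ 'm \<Rightarrow> real" and b :: "'m::finite \<Rightarrow> real ^ 'm"
  assumes B: "bilinear B" and b: "\<And>i j. B (b i) (b j) = (if i = j then \<epsilon> i else 0)"
    and eps: "\<And>i. \<epsilon> i = 1 \<or> \<epsilon> i = -1" and T: "linear T"
  shows "trace (matrix T) = (\<Sum>i\<in>UNIV. \<epsilon> i * B (T (b i)) (b i))"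
proof -
  have "T (axis k 1) $ k = (\<Sum>i\<in>UNIV. \<epsilon> i * B (axis k 1) (b i) * T (b i) $ k)" for k
  proof -
    have "T (axis k 1) = T (\<Sum>i\<in>UNIV. (\<epsilon> i * B (axis k 1) (b i)) *\<^sub>R b i)"
      using pseudo_orthonormal_expansion[OF B b eps] by metis
    also have "\<dots> = (\<Sum>i\<in>UNIV. (\<epsilon> i * B (axis k 1) (b i)) *\<^sub>R T (b i))"
      using T by (simp add: linear_sum linear_scale)
    finally show ?thesis by simp
  qed
  then have "trace (matrix T) = (\<Sum>k\<in>UNIV. \<Sum>i\<in>UNIV. \<epsilon> i * B (axis k 1) (b i) * T (b i) $ k)"
    by (simp add: trace_def matrix_def)
  also have "\<dots> = (\<Sum>i\<in>UNIV. \<Sum>k\<in>UNIV. \<epsilon> i * B (axis k 1) (b i) * T (b i) $ k)"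
    by (rule sum.swap)
  also have "\<dots> = (\<Sum>i\<in>UNIV. \<epsilon> i * B (T (b i)) (b i))"
  proof (rule sum.cong[OF refl])
    fix i
    have "B (T (b i)) (b i) = B (\<Sum>k\<in>UNIV. (T (b i) $ k) *\<^sub>R axis k 1) (b i)"
      using basis_expansion[of "T (b i)"] by (simp add: scalar_mult_eq_scaleR)
    also have "\<dots> = (\<Sum>k\<in>UNIV. T (b i) $ k * B (axis k 1) (b i))"
      by (rule bilinear_sum_scale_left[OF B])
    finally show "(\<Sum>k\<in>UNIV. \<epsilon> i * B (axis k 1) (b i) * T (b i) $ k) = \<epsilon> i * B (T (b i)) (b i)"
      by (simp add: sum_distrib_left ac_simps)
  qed
  finally show ?thesis .
qed

context pseudo_riemannian
begin

lemma bilinear_metric: "p \<in> pts M \<Longrightarrow> bilinear (g p)"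
  using metric_tensor unfolding bilinear_field_def by blast

lemma smooth_metric:
  "\<lbrakk>openin (mtop M) U; smooth_vfield M U X; smooth_vfield M U Y\<rbrakk>
    \<Longrightarrow> smooth_fun M U (\<lambda>q. g q (X q) (Y q))"
  using metric_tensor unfolding bilinear_field_def by blast

lemma pseudo_orthonormal_basis:
  assumes "p \<in> pts M"
  obtains b and \<epsilon> :: "'m \<Rightarrow> real" where "\<And>i j. g p (b i) (b j) = (if i = j then \<epsilon> i else 0)"
    "\<And>i. \<epsilon> i = 1 \<or> \<epsilon> i = -1"
proof -
  from metric_signature[OF assms] show ?thesis
    unfolding has_signature_def
  proof (elim exE conjE)
    fix b :: "'m \<Rightarrow> real ^ 'm"
    assume off: "\<forall>i j. i \<noteq> j \<longrightarrow> g p (b i) (b j) = 0"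
      and diag: "\<forall>i. g p (b i) (b i) = 1 \<or> g p (b i) (b i) = -1"
    show ?thesis
    proof (rule that)
      show "g p (b i) (b j) = (if i = j then g p (b i) (b i) else 0)" for i j using off by simp
      show "g p (b i) (b i) = 1 \<or> g p (b i) (b i) = -1" for i using diag by blast
    qed
  qed
qed

lemma metric_nondegenerate:
  assumes "p \<in> pts M" "\<And>u. g p w u = 0"
  shows "w = 0"
proof -
  obtain b and \<epsilon> :: "'m \<Rightarrow> real" where "\<And>i j. g p (b i) (b j) = (if i = j then \<epsilon> i else 0)" "\<And>i. \<epsilon> i = 1 \<or> \<epsilon> i = -1"
    using pseudo_orthonormal_basis[OF assms(1)] by metis
  from pseudo_orthonormal_expansion[OF bilinear_metric[OF assms(1)] this, of w]
  show ?thesis by (simp add: assms(2))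
qed

lemma metric_eqI:
  assumes "p \<in> pts M" "\<And>u. g p w u = g p w' u"
  shows "w = w'"
  using metric_nondegenerate[OF assms(1), of "w - w'"] assms(2)
  by (simp add: bilinear_lsub[OF bilinear_metric[OF assms(1)]])

text \<open>Gram-Schmidt, starting from the coordinate fields whose values at \<open>p\<close> form a pseudo-orthonormal
  basis.  For an indefinite form the procedure may meet a null vector.  Here it does not, since
  at \<open>p\<close> each step returns the given basis vector: the new vector has square \<open>\<plusminus> 1\<close> at \<open>p\<close>, hence a
  square of the same sign nearby, which is what normalization needs.\<close>

lemma exists_pseudo_orthonormal_frame:
  assumes p: "p \<in> pts M"
  shows "\<exists>U E \<epsilon>. p \<in> U \<and> pseudo_orthonormal_frame M g U E \<epsilon>"
proof -
  obtain b and \<epsilon> :: "'m \<Rightarrow> real" where b: "\<And>i j. g p (b i) (b j) = (if i = j then \<epsilon> i else 0)"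
    and eps: "\<And>i. \<epsilon> i = 1 \<or> \<epsilon> i = -1"
    using pseudo_orthonormal_basis[OF p] by metis
  have eps2: "\<epsilon> i * \<epsilon> i = 1" for i using eps[of i] by auto
  define c where "c = chart_at M p"
  have c: "c \<in> atlas M" "p \<in> fst c" using p by (auto simp: c_def chart_at_atlas in_chart_at)
  have "\<exists>U E. openin (mtop M) U \<and> p \<in> U \<and> U \<subseteq> fst c \<and>
      (\<forall>i\<in>K. smooth_vfield M U (E i) \<and> E i p = b i) \<and>
      (\<forall>q\<in>U. \<forall>i\<in>K. \<forall>j\<in>K. g q (E i q) (E j q) = (if i = j then \<epsilon> i else 0))" for K :: "'m set"
  proof (induction K rule: finite_induct[OF finite])
    case 1
    show ?case using c openin_chart[OF c(1)] by blast
  next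
    case (2 k K)
    then obtain U E where U: "openin (mtop M) U" "p \<in> U" "U \<subseteq> fst c"
      and E: "\<And>i. i \<in> K \<Longrightarrow> smooth_vfield M U (E i)" "\<And>i. i \<in> K \<Longrightarrow> E i p = b i"
      and on: "\<And>q i j. \<lbrakk>q \<in> U; i \<in> K; j \<in> K\<rbrakk> \<Longrightarrow> g q (E i q) (E j q) = (if i = j then \<epsilon> i else 0)"
      by blast
    define A where "A = const_field M c (b k)"
    define W where "W = (\<lambda>q. A q - (\<Sum>j\<in>K. (\<epsilon> j * g q (A q) (E j q)) *\<^sub>R E j q))"
    define f where "f = (\<lambda>q. \<epsilon> k * g q (W q) (W q))"
    have A: "smooth_vfield M U A" "A p = b k"
      using smooth_vfield_subset[OF smooth_const_field[OF c(1)] U(3)] p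
      by (auto simp: A_def c_def const_field_chart_at)
    have W: "smooth_vfield M U W" unfolding W_def
      by (intro smooth_vfield_diff smooth_vfield_sum smooth_vfield_scale smooth_fun_mult
          smooth_fun_const smooth_metric U A E)
    have "(\<Sum>j\<in>K. (\<epsilon> j * g p (A p) (E j p)) *\<^sub>R E j p) = 0"
      using 2(2) by (intro sum.neutral) (auto simp: A E b)
    then have Wp: "W p = b k" by (simp add: W_def A)
    have f: "smooth_fun M U f" unfolding f_def
      by (intro smooth_fun_mult smooth_fun_const smooth_metric U W)
    have fp: "f p = 1" by (simp add: f_def Wp b eps2)
    obtain V where V: "openin (mtop M) V" "p \<in> V" "V \<subseteq> U" and pos: "\<And>q. q \<in> V \<Longrightarrow> f q > 0"
      using smooth_fun_openin_pos[OF U(1) f U(2)] fp by auto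
    have WE: "g q (W q) (E j q) = 0" if "q \<in> V" "j \<in> K" for q j
    proof -
      have q: "q \<in> U" "q \<in> pts M" using that V openin_subset by auto
      have "g q (W q) (E j q) = g q (A q) (E j q)
          - (\<Sum>i\<in>K. (\<epsilon> i * g q (A q) (E i q)) * g q (E i q) (E j q))"
        unfolding W_def bilinear_lsub[OF bilinear_metric[OF q(2)]]
          bilinear_sum_scale_left[OF bilinear_metric[OF q(2)]] ..
      also have "(\<Sum>i\<in>K. (\<epsilon> i * g q (A q) (E i q)) * g q (E i q) (E j q))
          = (\<Sum>i\<in>K. if i = j then g q (A q) (E j q) else 0)"
        using that eps2[of j] by (intro sum.cong) (auto simp: on[OF q(1)])
      finally show ?thesis using 2(1) that by simp
    qed
    define E' where "E' = E(k := (\<lambda>q. (f q powr (-1/2)) *\<^sub>R W q))"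
    have "smooth_vfield M V (\<lambda>q. (f q powr (-1/2)) *\<^sub>R W q)"
      by (intro smooth_vfield_scale smooth_fun_powr V pos smooth_fun_subset[OF f V(3)]
          smooth_vfield_subset[OF W V(3)])
    then have "\<forall>i\<in>insert k K. smooth_vfield M V (E' i) \<and> E' i p = b i"
      using E smooth_vfield_subset[OF _ V(3)] 2(2) by (auto simp: E'_def fp Wp)
    moreover have "\<forall>q\<in>V. \<forall>i\<in>insert k K. \<forall>j\<in>insert k K. g q (E' i q) (E' j q) = (if i = j then \<epsilon> i else 0)"
    proof
      fix q assume q: "q \<in> V"
      then have qp: "q \<in> pts M" "q \<in> U" using V openin_subset by auto
      have "f q powr (-1/2) * (f q powr (-1/2) * g q (W q) (W q)) = f q powr (-1) * g q (W q) (W q)"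
        by (simp add: powr_add[symmetric] mult.assoc[symmetric])
      also have "\<dots> = \<epsilon> k"
        using pos[OF q] eps[of k] unfolding f_def by (auto simp: powr_minus_divide)
      finally have kk: "f q powr (-1/2) * (f q powr (-1/2) * g q (W q) (W q)) = \<epsilon> k" .
      have EW: "g q (E j q) (W q) = 0" if "j \<in> K" for j
        using WE[OF q that] metric_sym[OF qp(1), of "E j q" "W q"] by simp
      show "\<forall>i\<in>insert k K. \<forall>j\<in>insert k K. g q (E' i q) (E' j q) = (if i = j then \<epsilon> i else 0)"
        using kk on[OF qp(2)] WE[OF q] EW 2(2)
        by (auto simp: E'_def bilinear_lmul[OF bilinear_metric[OF qp(1)]]
            bilinear_rmul[OF bilinear_metric[OF qp(1)]])
    qed
    moreover have "V \<subseteq> fst c" using V(3) U(3) by (rule subset_trans)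
    ultimately have "openin (mtop M) V \<and> p \<in> V \<and> V \<subseteq> fst c \<and>
      (\<forall>i\<in>insert k K. smooth_vfield M V (E' i) \<and> E' i p = b i) \<and>
      (\<forall>q\<in>V. \<forall>i\<in>insert k K. \<forall>j\<in>insert k K. g q (E' i q) (E' j q) = (if i = j then \<epsilon> i else 0))"
      using V(1,2) by (intro conjI)
    then show ?case by (intro exI)
  qed
  from this[of UNIV] show ?thesis
  proof (elim exE conjE)
    fix U E
    assume "openin (mtop M) U" "p \<in> U" "\<forall>i\<in>UNIV. smooth_vfield M U (E i) \<and> E i p = b i"
      "\<forall>q\<in>U. \<forall>i\<in>UNIV. \<forall>j\<in>UNIV. g q (E i q) (E j q) = (if i = j then \<epsilon> i else 0)"
    then have "p \<in> U \<and> pseudo_orthonormal_frame M g U E \<epsilon>"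
      using eps by (simp add: pseudo_orthonormal_frame_def)
    then show ?thesis by (intro exI)
  qed
qed

lemma frame_expansion:
  assumes "pseudo_orthonormal_frame M g U E \<epsilon>" "q \<in> U"
  shows "v = (\<Sum>i\<in>UNIV. (\<epsilon> i * g q v (E i q)) *\<^sub>R E i q)"
proof -
  have "q \<in> pts M" using assms openin_subset unfolding pseudo_orthonormal_frame_def by blast
  then show ?thesis
    using assms unfolding pseudo_orthonormal_frame_def
    by (intro pseudo_orthonormal_expansion bilinear_metric) auto
qed

lemma trace_frame:
  assumes "pseudo_orthonormal_frame M g U E \<epsilon>" "q \<in> U" "linear T"
  shows "trace (matrix T) = (\<Sum>i\<in>UNIV. \<epsilon> i * g q (T (E i q)) (E i q))"
proof -
  have "q \<in> pts M" using assms openin_subset unfolding pseudo_orthonormal_frame_def by blast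
  then show ?thesis
    using assms unfolding pseudo_orthonormal_frame_def
    by (intro trace_pseudo_orthonormal bilinear_metric) auto
qed

end

section \<open>The Levi-Civita connection and its curvature\<close>

locale levi_civita_manifold = pseudo_riemannian M r s g + levi_civita M g nabla
  for M :: "('a, 'm::finite) premanifold" and r s g nabla
begin

text \<open>Locality of the connection.  A field vanishing on \<open>U\<close> is unchanged, as a total function, when
  multiplied by the function that is \<open>0\<close> on \<open>U\<close> and \<open>1\<close> elsewhere; that function is smooth on \<open>U\<close>, and
  linearity over functions applies.\<close>

lemma nabla_zero_left:
  assumes "openin (mtop M) U" "p \<in> U" "smooth_vfield M U Y" "smooth_vfield M U X"
    "\<And>q. q \<in> U \<Longrightarrow> X q = 0"
  shows "nabla X Y p = 0"
proof -
  define f where "f = (\<lambda>q. if q \<in> U then 0 else 1 :: real)"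
  have "smooth_fun M U f"
    by (rule smooth_fun_cong[OF assms(1) _ smooth_fun_const[of U 0]]) (simp add: f_def)
  from nabla_scale_left[OF assms(1) this assms(4,3,2)]
  have "nabla (\<lambda>q. f q *\<^sub>R X q) Y p = 0" using assms(2) by (simp add: f_def)
  moreover have "(\<lambda>q. f q *\<^sub>R X q) = X" using assms(5) by (auto simp: f_def)
  ultimately show ?thesis by simp
qed

text \<open>The same multiplication works in the second argument: in the Leibniz rule both terms vanish at \<open>p\<close>.\<close>

lemma nabla_zero_right:
  assumes "openin (mtop M) U" "p \<in> U" "smooth_vfield M U X" "smooth_vfield M U Y"
    "\<And>q. q \<in> U \<Longrightarrow> Y q = 0"
  shows "nabla X Y p = 0"
proof -
  define f where "f = (\<lambda>q. if q \<in> U then 0 else 1 :: real)"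
  have "smooth_fun M U f"
    by (rule smooth_fun_cong[OF assms(1) _ smooth_fun_const[of U 0]]) (simp add: f_def)
  from nabla_leibniz[OF assms(1) this assms(3,4,2)]
  have "nabla X (\<lambda>q. f q *\<^sub>R Y q) p = 0" using assms(2,5) by (simp add: f_def)
  moreover have "(\<lambda>q. f q *\<^sub>R Y q) = Y" using assms(5) by (auto simp: f_def)
  ultimately show ?thesis by simp
qed

lemma nabla_cong:
  assumes "openin (mtop M) U" "p \<in> U" "smooth_vfield M U X" "smooth_vfield M U Y"
    "\<And>q. q \<in> U \<Longrightarrow> X q = X' q" "\<And>q. q \<in> U \<Longrightarrow> Y q = Y' q"
  shows "nabla X Y p = nabla X' Y' p"
proof -
  have X': "smooth_vfield M U X'" and Y': "smooth_vfield M U Y'"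
    using smooth_vfield_cong assms by blast+
  have "nabla X Y p = nabla X' Y p + nabla (\<lambda>q. X q - X' q) Y p"
    using nabla_add_left[OF assms(1) X' smooth_vfield_diff[OF assms(1,3) X'] assms(4,2)] by simp
  also have "nabla (\<lambda>q. X q - X' q) Y p = 0"
    by (rule nabla_zero_left[OF assms(1,2,4) smooth_vfield_diff[OF assms(1,3) X']]) (simp add: assms)
  also have "nabla X' Y p = nabla X' Y' p + nabla X' (\<lambda>q. Y q - Y' q) p"
    using nabla_add_right[OF assms(1) X' Y' smooth_vfield_diff[OF assms(1,4) Y'] assms(2)] by simp
  also have "nabla X' (\<lambda>q. Y q - Y' q) p = 0"
    by (rule nabla_zero_right[OF assms(1,2) X' smooth_vfield_diff[OF assms(1,4) Y']]) (simp add: assms)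
  finally show ?thesis by simp
qed

lemma nabla_minus_right:
  assumes "openin (mtop M) U" "p \<in> U" "smooth_vfield M U X" "smooth_vfield M U Y" "smooth_vfield M U Y'"
  shows "nabla X (\<lambda>q. Y q - Y' q) p = nabla X Y p - nabla X Y' p"
  using nabla_add_right[OF assms(1,3,5) smooth_vfield_diff[OF assms(1,4,5)] assms(2)] by simp

lemma nabla_sum_left:
  assumes "openin (mtop M) U" "p \<in> U" "smooth_vfield M U Y"
    "\<And>i. i \<in> I \<Longrightarrow> smooth_fun M U (f i)" "\<And>i. i \<in> I \<Longrightarrow> smooth_vfield M U (X i)"
  shows "nabla (\<lambda>q. \<Sum>i\<in>I. f i q *\<^sub>R X i q) Y p = (\<Sum>i\<in>I. f i p *\<^sub>R nabla (X i) Y p)"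
  using assms(4,5)
proof (induction I rule: infinite_finite_induct)
  case (insert i I)
  then show ?case
    using assms(1-3)
    by (simp add: nabla_add_left[OF assms(1)] nabla_scale_left[OF assms(1)]
        smooth_vfield_sum smooth_vfield_scale)
qed (auto intro: nabla_zero_left[OF assms(1-3) smooth_vfield_zero[OF assms(1)]])

text \<open>Expand \<open>X\<close> in a local frame; the coefficients are the smooth functions \<open>\<epsilon>\<^sub>i g(X, E\<^sub>i)\<close>, and
  linearity over functions leaves only their values at \<open>p\<close>.\<close>

lemma nabla_pointwise:
  assumes U: "openin (mtop M) U" "p \<in> U" and X: "smooth_vfield M U X" and X': "smooth_vfield M U X'"
    and Y: "smooth_vfield M U Y" and eq: "X p = X' p"
  shows "nabla X Y p = nabla X' Y p"
proof -
  have p: "p \<in> pts M" using U openin_subset by blast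
  obtain V E \<epsilon> where V: "p \<in> V" and E: "pseudo_orthonormal_frame M g V E \<epsilon>"
    using exists_pseudo_orthonormal_frame[OF p] by metis
  let ?W = "U \<inter> V"
  have W: "openin (mtop M) ?W" "p \<in> ?W"
    using U V E unfolding pseudo_orthonormal_frame_def by auto
  have E': "smooth_vfield M ?W (E i)" for i
    using E smooth_vfield_subset[of V] unfolding pseudo_orthonormal_frame_def by auto
  have Y': "smooth_vfield M ?W Y" using Y smooth_vfield_subset by blast
  have "nabla Z Y p = (\<Sum>i\<in>UNIV. (\<epsilon> i * g p (Z p) (E i p)) *\<^sub>R nabla (E i) Y p)"
    if "smooth_vfield M U Z" for Z
  proof -
    have Z: "smooth_vfield M ?W Z" using that smooth_vfield_subset by blast
    have "nabla Z Y p = nabla (\<lambda>q. \<Sum>i\<in>UNIV. (\<epsilon> i * g q (Z q) (E i q)) *\<^sub>R E i q) Y p"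
      by (rule nabla_cong[OF W Z Y']) (use frame_expansion[OF E] in auto)
    also have "\<dots> = (\<Sum>i\<in>UNIV. (\<epsilon> i * g p (Z p) (E i p)) *\<^sub>R nabla (E i) Y p)"
      by (rule nabla_sum_left[OF W Y'])
        (intro E' smooth_fun_mult smooth_fun_const smooth_metric W Z)+
    finally show ?thesis .
  qed
  from this[OF X] this[OF X'] eq show ?thesis by simp
qed

lemma smooth_lie_bracket:
  assumes "openin (mtop M) U" "smooth_vfield M U X" "smooth_vfield M U Y"
  shows "smooth_vfield M U (lie_bracket M X Y)"
  by (rule smooth_vfield_cong[OF assms(1) _ smooth_vfield_diff[OF assms(1)
          nabla_smooth[OF assms] nabla_smooth[OF assms(1,3,2)]]])
    (rule nabla_torsion_free[OF assms])

text \<open>Metric compatibility turns \<open>[X, Y] g(Z, W) = X(Y g(Z, W)) - Y(X g(Z, W))\<close> into this identity; the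
  mixed terms \<open>g(\<nabla>\<^sub>X Z, \<nabla>\<^sub>Y W)\<close> are symmetric in \<open>X\<close> and \<open>Y\<close> and cancel.\<close>

lemma curvature_skew:
  assumes U: "openin (mtop M) U" "p \<in> U" and X: "smooth_vfield M U X" and Y: "smooth_vfield M U Y"
    and Z: "smooth_vfield M U Z" and W: "smooth_vfield M U W"
  shows "g p (curvature M nabla X Y Z p) (W p) = - g p (Z p) (curvature M nabla X Y W p)"
proof -
  have p: "p \<in> pts M" using U openin_subset by blast
  have second: "dirderiv M A (dirderiv M B (\<lambda>q. g q (Z q) (W q))) p =
      g p (nabla A (nabla B Z) p) (W p) + g p (nabla B Z p) (nabla A W p)
      + g p (nabla A Z p) (nabla B W p) + g p (Z p) (nabla A (nabla B W) p)"
    if A: "smooth_vfield M U A" and B: "smooth_vfield M U B" for A B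
  proof -
    note BZ = nabla_smooth[OF U(1) B Z] and BW = nabla_smooth[OF U(1) B W]
    note s1 = smooth_metric[OF U(1) BZ W] and s2 = smooth_metric[OF U(1) Z BW]
    have "dirderiv M A (dirderiv M B (\<lambda>q. g q (Z q) (W q))) p
        = dirderiv M A (\<lambda>q. g q (nabla B Z q) (W q) + g q (Z q) (nabla B W q)) p"
      by (rule dirderiv_cong[OF U smooth_fun_add[OF U(1) s1 s2], symmetric])
        (simp_all add: nabla_metric[OF U(1) B Z W])
    then show ?thesis
      by (simp add: dirderiv_add[OF U s1 s2] nabla_metric[OF U(1) A BZ W U(2)]
          nabla_metric[OF U(1) A Z BW U(2)])
  qed
  have "g p (nabla (lie_bracket M X Y) Z p) (W p) + g p (Z p) (nabla (lie_bracket M X Y) W p)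
      = dirderiv M X (dirderiv M Y (\<lambda>q. g q (Z q) (W q))) p - dirderiv M Y (dirderiv M X (\<lambda>q. g q (Z q) (W q))) p"
    using nabla_metric[OF U(1) smooth_lie_bracket[OF U(1) X Y] Z W U(2)]
      dirderiv_lie_bracket[OF U smooth_metric[OF U(1) Z W] X Y] by simp
  then show ?thesis
    unfolding second[OF X Y] second[OF Y X] curvature_def
    by (simp add: bilinear_lsub[OF bilinear_metric[OF p]] bilinear_rsub[OF bilinear_metric[OF p]])
qed

lemma nabla_const_field_commute:
  assumes "c \<in> atlas M" "q \<in> fst c"
  shows "nabla (const_field M c u) (const_field M c v) q = nabla (const_field M c v) (const_field M c u) q"
  using nabla_torsion_free[OF openin_chart[OF assms(1)] smooth_const_field[OF assms(1)]
      smooth_const_field[OF assms(1)] assms(2), of u v] lie_bracket_const_field[OF assms]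
  by simp

lemma curvature_const_field:
  assumes c: "c \<in> atlas M" "q \<in> fst c" and U: "openin (mtop M) U" "q \<in> U" and Z: "smooth_vfield M U Z"
  shows "curvature M nabla (const_field M c u) (const_field M c v) Z q
    = nabla (const_field M c u) (nabla (const_field M c v) Z) q
      - nabla (const_field M c v) (nabla (const_field M c u) Z) q"
proof -
  let ?b = "lie_bracket M (const_field M c u) (const_field M c v)"
  have "nabla ?b Z q = 0"
  proof (rule nabla_zero_left)
    show "openin (mtop M) (U \<inter> fst c)" using openin_Int_chart U c by blast
    show "smooth_vfield M (U \<inter> fst c) ?b"
      by (rule smooth_vfield_subset[OF smooth_lie_bracket[OF openin_chart smooth_const_field
            smooth_const_field]]) (use c in auto)
    show "smooth_vfield M (U \<inter> fst c) Z" using Z smooth_vfield_subset by blast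
  qed (use c U lie_bracket_const_field in auto)
  then show ?thesis by (simp add: curvature_def)
qed

context
  fixes p assumes p: "p \<in> pts M"
begin

abbreviation (input) "ext \<equiv> const_field M (chart_at M p)"
abbreviation (input) "Riem \<equiv> curvature_at M nabla p"

lemma chart_at_p: "chart_at M p \<in> atlas M" "p \<in> fst (chart_at M p)"
  "openin (mtop M) (fst (chart_at M p))"
  using p by (auto simp: chart_at_atlas in_chart_at openin_chart)

lemma ext_smooth: "smooth_vfield M (fst (chart_at M p)) (ext v)"
  by (rule smooth_const_field[OF chart_at_p(1)])

lemma ext_p: "ext v p = v"
  by (rule const_field_chart_at[OF p])

lemma nabla_ext_smooth: "smooth_vfield M (fst (chart_at M p)) (nabla (ext u) (ext v))"
  by (rule nabla_smooth[OF chart_at_p(3) ext_smooth ext_smooth])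

lemma curvature_at_eq:
  "Riem u v w = nabla (ext u) (nabla (ext v) (ext w)) p - nabla (ext v) (nabla (ext u) (ext w)) p"
  unfolding curvature_at_def Let_def
  by (rule curvature_const_field[OF chart_at_p(1,2,3,2) ext_smooth])

text \<open>By skew-symmetry \<open>g(R(X, Y) Z, W) = - g(Z, R(X, Y) W)\<close>, and the right-hand side involves only the
  value of \<open>Z\<close> at \<open>p\<close>.\<close>

lemma curvature_at_field:
  assumes U: "openin (mtop M) U" "p \<in> U" and Z: "smooth_vfield M U Z"
  shows "curvature M nabla (ext u) (ext v) Z p = Riem u v (Z p)"
proof (rule metric_eqI[OF p])
  fix w
  let ?U = "U \<inter> fst (chart_at M p)"
  have U': "openin (mtop M) ?U" "p \<in> ?U" using openin_Int_chart U chart_at_p by blast+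
  have Z': "smooth_vfield M ?U Z" using Z smooth_vfield_subset by blast
  have e: "smooth_vfield M ?U (ext v)" for v using ext_smooth smooth_vfield_subset by blast
  show "g p (curvature M nabla (ext u) (ext v) Z p) w = g p (Riem u v (Z p)) w"
    using curvature_skew[OF U' e e Z' e, of u v w] curvature_skew[OF U' e e e e, of u v "Z p" w]
    by (simp add: ext_p curvature_at_def Let_def)
qed

lemma curvature_at_antisym: "Riem u v w = - Riem v u w"
  by (simp add: curvature_at_eq)

lemma curvature_at_skew: "g p (Riem u v w) z = - g p w (Riem u v z)"
  using curvature_skew[OF chart_at_p(3,2) ext_smooth ext_smooth ext_smooth ext_smooth, of u v w z]
  by (simp add: ext_p curvature_at_def Let_def)

text \<open>For commuting fields the cyclic sum regroups into terms \<open>\<nabla>\<^sub>X (\<nabla>\<^sub>Y Z - \<nabla>\<^sub>Z Y)\<close>, which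
  vanish by torsion-freeness.\<close>

lemma first_bianchi: "Riem u v w + Riem v w u + Riem w u v = 0"
proof -
  have "nabla (ext u) (nabla (ext v) (ext w)) p = nabla (ext u) (nabla (ext w) (ext v)) p" for u v w
    by (rule nabla_cong[OF chart_at_p(3,2) ext_smooth nabla_ext_smooth])
      (simp_all add: nabla_const_field_commute[OF chart_at_p(1)])
  from this[of u v w] this[of v w u] this[of w u v] show ?thesis by (simp add: curvature_at_eq)
qed

lemma linear_curvature_at: "linear (\<lambda>u. Riem u v w)"
proof (rule linearI)
  fix u u' :: "real ^ 'm" and k :: real
  have add: "ext (u + u') q = ext u q + ext u' q" and scale: "ext (k *\<^sub>R u) q = k *\<^sub>R ext u q"
    if "q \<in> fst (chart_at M p)" for q
    using linear_add[OF linear_const_field[OF chart_at_p(1) that]] linear_scale[OF linear_const_field[OF chart_at_p(1) that]]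
    by auto
  note s = smooth_vfield_add[OF chart_at_p(3) ext_smooth ext_smooth]
    and t = smooth_vfield_scale[OF chart_at_p(3) smooth_fun_const ext_smooth]
  have add1: "nabla (ext (u + u')) Z q = nabla (ext u) Z q + nabla (ext u') Z q"
    if "smooth_vfield M (fst (chart_at M p)) Z" "q \<in> fst (chart_at M p)" for Z q
    using nabla_cong[OF chart_at_p(3) that(2) ext_smooth that(1) add refl]
      nabla_add_left[OF chart_at_p(3) ext_smooth ext_smooth that] by simp
  have add2: "nabla (ext v) (nabla (ext (u + u')) (ext w)) p
      = nabla (ext v) (nabla (ext u) (ext w)) p + nabla (ext v) (nabla (ext u') (ext w)) p"
    using nabla_cong[OF chart_at_p(3,2) ext_smooth nabla_ext_smooth refl add1[OF ext_smooth], of v w]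
      nabla_add_right[OF chart_at_p(3) ext_smooth nabla_ext_smooth nabla_ext_smooth chart_at_p(2)] by simp
  show "Riem (u + u') v w = Riem u v w + Riem u' v w"
    by (simp add: curvature_at_eq add1[OF nabla_ext_smooth chart_at_p(2)] add2)
  have scale1: "nabla (ext (k *\<^sub>R u)) Z q = k *\<^sub>R nabla (ext u) Z q"
    if "smooth_vfield M (fst (chart_at M p)) Z" "q \<in> fst (chart_at M p)" for Z q
    using nabla_cong[OF chart_at_p(3) that(2) ext_smooth that(1) scale refl]
      nabla_scale_left[OF chart_at_p(3) smooth_fun_const ext_smooth that] by simp
  have scale2: "nabla (ext v) (nabla (ext (k *\<^sub>R u)) (ext w)) p
      = k *\<^sub>R nabla (ext v) (nabla (ext u) (ext w)) p"
    using nabla_cong[OF chart_at_p(3,2) ext_smooth nabla_ext_smooth refl scale1[OF ext_smooth], of v w]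
      nabla_leibniz[OF chart_at_p(3) smooth_fun_const ext_smooth nabla_ext_smooth chart_at_p(2)]
    by (simp add: dirderiv_const)
  show "Riem (k *\<^sub>R u) v w = k *\<^sub>R Riem u v w"
    by (simp add: curvature_at_eq scale1[OF nabla_ext_smooth chart_at_p(2)] scale2 scaleR_diff_right)
qed

lemma ricci_frame:
  assumes "pseudo_orthonormal_frame M g U E \<epsilon>" "p \<in> U"
  shows "ricci M nabla p v w = (\<Sum>i\<in>UNIV. \<epsilon> i * g p (Riem (E i p) v w) (E i p))"
  unfolding ricci_def by (rule trace_frame[OF assms linear_curvature_at])

text \<open>By the first Bianchi identity the difference of the two sides is, up to sign, the trace of
  \<open>R(v, w)\<close>, which is skew-adjoint.\<close>

lemma ricci_sym: "ricci M nabla p v w = ricci M nabla p w v"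
proof -
  obtain U E \<epsilon> where E: "pseudo_orthonormal_frame M g U E \<epsilon>" "p \<in> U"
    using exists_pseudo_orthonormal_frame[OF p] by metis
  have "g p (Riem e v w) e = g p (Riem e w v) e" for e
  proof -
    have "Riem e v w = Riem e w v - Riem v w e"
      using first_bianchi[of e v w] curvature_at_antisym[of e w v]
      unfolding eq_diff_eq eq_neg_iff_add_eq_0 by (metis add_right_cancel)
    moreover have "g p (Riem v w e) e = 0"
      using curvature_at_skew[of v w e e] metric_sym[OF p, of "Riem v w e" e] by simp
    ultimately show ?thesis by (simp add: bilinear_lsub[OF bilinear_metric[OF p]])
  qed
  then show ?thesis by (simp add: ricci_frame[OF E])
qed

end

end

section \<open>The trace of the covariant derivative of the Reeb field\<close>

lemma trace_matrix: "trace (matrix T) = (\<Sum>k\<in>UNIV. T (axis k 1) $ k)"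
  by (simp add: trace_def matrix_def)

lemma trace_compose_commute:
  fixes S T :: "real ^ 'm::finite \<Rightarrow> real ^ 'm"
  assumes "linear S" "linear T"
  shows "trace (matrix (\<lambda>v. S (T v))) = trace (matrix (\<lambda>v. T (S v)))"
proof -
  have 1: "matrix (\<lambda>v. S (T v)) = matrix S ** matrix T"
    using matrix_compose[OF assms(2,1)] by (simp add: o_def)
  have 2: "matrix (\<lambda>v. T (S v)) = matrix T ** matrix S"
    using matrix_compose[OF assms] by (simp add: o_def)
  show ?thesis unfolding 1 2 by (rule trace_mul_sym)
qed

lemma trace_rank_one:
  fixes x :: "real ^ 'm::finite" and h :: "real ^ 'm \<Rightarrow> real"
  assumes "linear h"
  shows "trace (matrix (\<lambda>v. h v *\<^sub>R x)) = h x"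
proof -
  have "h x = h (\<Sum>k\<in>UNIV. (x $ k) *\<^sub>R axis k 1)"
    using basis_expansion[of x] by (simp add: scalar_mult_eq_scaleR)
  also have "\<dots> = (\<Sum>k\<in>UNIV. x $ k * h (axis k 1))"
    unfolding linear_sum[OF assms] linear_scale[OF assms] by simp
  finally show ?thesis by (simp add: trace_matrix mult.commute)
qed

text \<open>The linear algebra behind \<open>tr A = 2 n \<alpha>\<close>.  With \<open>N = 2 \<alpha> \<phi> - \<phi> A - A \<phi>\<close>, which will be
  \<open>\<nabla>\<^sub>\<xi> \<phi>\<close>, the last hypothesis says that \<open>N\<close> anticommutes with \<open>\<phi>\<close>; so \<open>tr (\<phi> N) = 0\<close>.  On the other
  hand \<open>tr (\<phi>\<^sup>2 A) = tr (\<phi> A \<phi>) = tr A\<close>, because \<open>A\<close> takes values in the kernel of \<open>\<eta>\<close>, where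
  \<open>\<phi>\<^sup>2 = Id\<close>.\<close>

lemma trace_almost_paracontact:
  fixes \<phi> A :: "real ^ 'm::finite \<Rightarrow> real ^ 'm" and \<eta> :: "real ^ 'm \<Rightarrow> real"
  assumes \<phi>: "linear \<phi>" and A: "linear A" and \<eta>: "linear \<eta>" and "\<eta> \<xi> = 1"
    and sq: "\<And>v. \<phi> (\<phi> v) = v - \<eta> v *\<^sub>R \<xi>" and "\<And>v. \<eta> (A v) = 0"
    and anti: "\<And>v. \<phi> ((2 * \<alpha>) *\<^sub>R \<phi> v - \<phi> (A v) - A (\<phi> v))
      + ((2 * \<alpha>) *\<^sub>R \<phi> (\<phi> v) - \<phi> (A (\<phi> v)) - A (\<phi> (\<phi> v))) = 0"
  shows "trace (matrix A) = \<alpha> * (CARD('m) - 1)"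
proof -
  have A\<phi>\<phi>: "trace (matrix (\<lambda>v. A (\<phi> (\<phi> v)))) = trace (matrix A)"
    using trace_compose_commute[OF A linear_compose[OF \<phi> \<phi>]] by (simp add: o_def sq assms)
  have \<phi>A\<phi>: "trace (matrix (\<lambda>v. \<phi> (A (\<phi> v)))) = trace (matrix A)"
    using trace_compose_commute[OF \<phi> linear_compose[OF \<phi> A]] by (simp add: A\<phi>\<phi> o_def)
  have id: "trace (matrix (\<lambda>v::real^'m. v)) = CARD('m)" by (simp add: trace_matrix)
  have \<phi>\<phi>: "trace (matrix (\<lambda>v. \<phi> (\<phi> v))) = CARD('m) - 1"
    using id trace_rank_one[OF \<eta>, of \<xi>] by (simp add: sq trace_matrix sum_subtractf assms)
  have zero: "(4 * \<alpha>) *\<^sub>R \<phi> (\<phi> v) - A v - 2 *\<^sub>R \<phi> (A (\<phi> v)) - A (\<phi> (\<phi> v)) = 0" for v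
  proof -
    have pull: "\<phi> ((2 * \<alpha>) *\<^sub>R \<phi> v - \<phi> (A v) - A (\<phi> v))
        = (2 * \<alpha>) *\<^sub>R \<phi> (\<phi> v) - A v - \<phi> (A (\<phi> v))"
      unfolding linear_diff[OF \<phi>] linear_scale[OF \<phi>] sq[of "A v"] assms(6) by simp
    have four: "(4 * \<alpha>) *\<^sub>R x = (2 * \<alpha>) *\<^sub>R x + (2 * \<alpha>) *\<^sub>R x" for x :: "real ^ 'm"
      unfolding scaleR_left_distrib[symmetric] by simp
    show ?thesis using anti[of v] unfolding pull four scaleR_2 by (simp only: algebra_simps)
  qed
  have "0 = trace (matrix (\<lambda>v. (4 * \<alpha>) *\<^sub>R \<phi> (\<phi> v) - A v - 2 *\<^sub>R \<phi> (A (\<phi> v)) - A (\<phi> (\<phi> v))))"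
    unfolding zero by (simp add: trace_matrix)
  also have "\<dots> = 4 * \<alpha> * trace (matrix (\<lambda>v. \<phi> (\<phi> v))) - trace (matrix A)
      - 2 * trace (matrix (\<lambda>v. \<phi> (A (\<phi> v)))) - trace (matrix (\<lambda>v. A (\<phi> (\<phi> v))))"
    by (simp add: trace_matrix sum_subtractf sum_distrib_left)
  finally show ?thesis unfolding A\<phi>\<phi> \<phi>A\<phi> \<phi>\<phi> by simp
qed

locale almost_para_kenmotsu_connection =
  almost_para_kenmotsu M n g \<phi> \<xi> \<eta> \<alpha> + levi_civita_manifold M "n + 1" n g nabla
  for M :: "('a, 'm::finite) premanifold" and n g \<phi> \<xi> \<eta> \<alpha> nabla
begin

context
  fixes p assumes p: "p \<in> pts M"
begin

lemmas g_add_left = bilinear_ladd[OF bilinear_metric[OF p]]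
  and g_diff_left = bilinear_lsub[OF bilinear_metric[OF p]]
  and g_diff_right = bilinear_rsub[OF bilinear_metric[OF p]]
  and g_scale_left = bilinear_lmul[OF bilinear_metric[OF p]]
  and g_scale_right = bilinear_rmul[OF bilinear_metric[OF p]]
  and g_zero_left = bilinear_lzero[OF bilinear_metric[OF p]]

lemma linear_phi: "linear (\<phi> p)"
  using phi_tensor p unfolding endo_field_def by blast

lemma linear_eta: "linear (\<eta> p)"
  using eta_form p unfolding one_form_def by blast

lemma xi_nonzero: "\<xi> p \<noteq> 0"
  using eta_xi[OF p] linear_0[OF linear_eta] by auto

text \<open>Since \<open>\<phi>\<^sup>2 \<xi> = 0\<close>, evaluating \<open>\<phi>\<^sup>2\<close> on \<open>\<phi> \<xi>\<close> shows that \<open>\<phi> \<xi> = k \<xi>\<close>, and then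
  \<open>k\<^sup>2 \<xi> = \<phi>\<^sup>2 \<xi> = 0\<close>.\<close>

lemma phi_xi: "\<phi> p (\<xi> p) = 0"
proof -
  define k where "k = \<eta> p (\<phi> p (\<xi> p))"
  have sq: "\<phi> p (\<phi> p (\<xi> p)) = 0" using phi_phi[OF p] eta_xi[OF p] by simp
  then have "\<phi> p (\<xi> p) = k *\<^sub>R \<xi> p"
    using phi_phi[OF p, of "\<phi> p (\<xi> p)"] linear_0[OF linear_phi] by (simp add: k_def)
  moreover from this have "k *\<^sub>R (k *\<^sub>R \<xi> p) = 0"
    using sq linear_scale[OF linear_phi, of k "\<xi> p"] by simp
  ultimately show ?thesis using xi_nonzero by simp
qed

text \<open>Compare the two ways of computing \<open>\<phi>\<^sup>3\<close>.\<close>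

lemma eta_phi: "\<eta> p (\<phi> p v) = 0"
proof -
  have "\<phi> p (\<phi> p (\<phi> p v)) = \<phi> p v"
    unfolding phi_phi[OF p, of v] linear_diff[OF linear_phi] linear_scale[OF linear_phi] phi_xi by simp
  then show ?thesis using phi_phi[OF p, of "\<phi> p v"] xi_nonzero by simp
qed

lemma eta_metric: "\<eta> p v = g p v (\<xi> p)"
  using compatible_metric[OF p, of v "\<xi> p"] eta_xi[OF p]
  by (simp add: phi_xi bilinear_rzero[OF bilinear_metric[OF p]])

lemma phi_skew: "g p (\<phi> p u) v = - g p u (\<phi> p v)"
  using compatible_metric[OF p, of u "\<phi> p v"] eta_metric[of "\<phi> p u"]
  by (simp add: phi_phi[OF p] eta_phi g_diff_right g_scale_right)

lemma metric_xi_xi: "g p (\<xi> p) (\<xi> p) = 1"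
  using eta_metric[of "\<xi> p"] eta_xi[OF p] by simp

end

text \<open>The endomorphism \<open>A = \<nabla> \<xi>\<close> of the tangent space; up to sign, its restriction to the kernel of \<open>\<eta>\<close> is
  the shape operator of the leaves of the foliation that \<open>\<eta>\<close> defines.\<close>

definition shape :: "'a \<Rightarrow> real ^ 'm \<Rightarrow> real ^ 'm"
  where "shape p v = nabla (const_field M (chart_at M p) v) \<xi> p"

context
  fixes U assumes U: "openin (mtop M) U"
begin

lemma in_pts: "q \<in> U \<Longrightarrow> q \<in> pts M"
  using U openin_subset by blast

lemma smooth_xi: "smooth_vfield M U \<xi>"
  by (rule smooth_vfield_subset[OF xi_smooth openin_subset[OF U]])

lemma smooth_phi: "smooth_vfield M U X \<Longrightarrow> smooth_vfield M U (\<lambda>q. \<phi> q (X q))"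
  using phi_tensor U unfolding endo_field_def by blast

lemma smooth_nabla_xi: "smooth_vfield M U X \<Longrightarrow> smooth_vfield M U (nabla X \<xi>)"
  by (rule nabla_smooth[OF U _ smooth_xi])

lemma dirderiv_eta:
  assumes X: "smooth_vfield M U X" and Y: "smooth_vfield M U Y" and p: "p \<in> U"
  shows "dirderiv M X (\<lambda>q. \<eta> q (Y q)) p = \<eta> p (nabla X Y p) + g p (Y p) (nabla X \<xi> p)"
proof -
  have "dirderiv M X (\<lambda>q. \<eta> q (Y q)) p = dirderiv M X (\<lambda>q. g q (Y q) (\<xi> q)) p"
    by (rule dirderiv_cong[OF U p smooth_metric[OF U Y smooth_xi], symmetric])
      (simp_all add: eta_metric in_pts)
  then show ?thesis
    by (simp add: nabla_metric[OF U X Y smooth_xi p] eta_metric in_pts p)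
qed

text \<open>This is \<open>d \<eta> = 0\<close>, written with \<open>\<eta> = g(\<cdot>, \<xi>)\<close> and the torsion-free connection.\<close>

lemma nabla_xi_symmetric:
  assumes X: "smooth_vfield M U X" and Y: "smooth_vfield M U Y" and p: "p \<in> U"
  shows "g p (nabla X \<xi> p) (Y p) = g p (nabla Y \<xi> p) (X p)"
proof -
  have "\<eta> p (lie_bracket M X Y p) = \<eta> p (nabla X Y p) - \<eta> p (nabla Y X p)"
    unfolding nabla_torsion_free[OF U X Y p, symmetric]
    by (rule linear_diff[OF linear_eta[OF in_pts[OF p]]])
  then show ?thesis
    using d_eta[OF U X Y p] metric_sym[OF in_pts[OF p]]
    by (simp add: d1_def dirderiv_eta[OF X Y p] dirderiv_eta[OF Y X p])
qed

lemma metric_nabla_xi_xi: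
  assumes X: "smooth_vfield M U X" and p: "p \<in> U"
  shows "g p (nabla X \<xi> p) (\<xi> p) = 0"
proof -
  have "dirderiv M X (\<lambda>q. g q (\<xi> q) (\<xi> q)) p = 0"
    by (rule dirderiv_locally_const[OF U p]) (rule metric_xi_xi[OF in_pts])
  then show ?thesis
    using nabla_metric[OF U X smooth_xi smooth_xi p]
      metric_sym[OF in_pts[OF p], of "\<xi> p" "nabla X \<xi> p"] by simp
qed

lemma nabla_xi_eq_shape:
  assumes X: "smooth_vfield M U X" and p: "p \<in> U"
  shows "nabla X \<xi> p = shape p (X p)"
proof -
  let ?c = "chart_at M p"
  have pp: "p \<in> pts M" by (rule in_pts[OF p])
  have W: "openin (mtop M) (U \<inter> fst ?c)" "p \<in> U \<inter> fst ?c"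
    using openin_Int_chart[OF U chart_at_atlas[OF pp]] p in_chart_at[OF pp] by auto
  show ?thesis unfolding shape_def
    by (rule nabla_pointwise[OF W])
      (auto intro: smooth_vfield_subset[OF X] smooth_vfield_subset[OF smooth_xi]
        smooth_vfield_subset[OF ext_smooth[OF pp]] simp: ext_p[OF pp])
qed

end

context
  fixes p assumes p: "p \<in> pts M"
begin

lemma shape_symmetric: "g p (shape p u) v = g p u (shape p v)"
  using nabla_xi_symmetric[OF chart_at_p(3)[OF p] ext_smooth[OF p] ext_smooth[OF p] chart_at_p(2)[OF p], of u v]
    metric_sym[OF p] by (simp add: shape_def ext_p[OF p])

text \<open>A self-adjoint map is linear: \<open>g(A u, w) = g(u, A w)\<close> is linear in \<open>u\<close>, and \<open>g\<close> is nondegenerate.\<close>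

lemma linear_shape: "linear (shape p)"
  by (rule linearI; rule metric_eqI[OF p])
    (simp_all add: shape_symmetric g_add_left[OF p] g_scale_left[OF p])

lemma eta_shape: "\<eta> p (shape p v) = 0"
  using metric_nabla_xi_xi[OF chart_at_p(3)[OF p] ext_smooth[OF p] chart_at_p(2)[OF p], of v]
  by (simp add: eta_metric[OF p] shape_def)

lemma shape_xi: "shape p (\<xi> p) = 0"
  by (rule metric_nondegenerate[OF p])
    (use eta_shape in \<open>simp add: shape_symmetric metric_sym[OF p, of "\<xi> p"] eta_metric[OF p]\<close>)

end

text \<open>The equation \<open>d \<Phi> = 2 \<alpha> \<eta> \<and> \<Phi>\<close> with \<open>\<xi>\<close> in one argument.  As \<open>\<phi> \<xi> = 0\<close>, the 2-form \<open>\<Phi>\<close> vanishes as soon as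
  one of its arguments is \<open>\<xi>\<close>, so of the derivatives only the one along \<open>\<xi>\<close> survives, and the brackets
  with \<open>\<xi>\<close> contribute the terms with \<open>A\<close>.\<close>

lemma nabla_xi_phi:
  assumes U: "openin (mtop M) U" "p \<in> U" and X: "smooth_vfield M U X"
  shows "nabla \<xi> (\<lambda>q. \<phi> q (X q)) p - \<phi> p (nabla \<xi> X p)
    = (2 * \<alpha>) *\<^sub>R \<phi> p (X p) - \<phi> p (shape p (X p)) - shape p (\<phi> p (X p))"
proof (rule metric_eqI)
  show p: "p \<in> pts M" by (rule in_pts[OF U])
  note lin = g_add_left[OF p] g_diff_left[OF p] g_scale_left[OF p] linear_diff[OF linear_phi[OF p]]
  fix y
  let ?W = "U \<inter> fst (chart_at M p)"
  define Y where "Y = const_field M (chart_at M p) y"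
  have W: "openin (mtop M) ?W" "p \<in> ?W"
    using openin_Int_chart[OF U(1) chart_at_atlas[OF p]] U in_chart_at[OF p] by auto
  have X: "smooth_vfield M ?W X" using X by (rule smooth_vfield_subset) simp
  have Y: "smooth_vfield M ?W Y" "Y p = y"
    using ext_smooth[OF p] smooth_vfield_subset ext_p[OF p] unfolding Y_def by blast+
  note xi = smooth_xi[OF W(1)]
  have "dirderiv M X (\<lambda>q. g q (\<phi> q (Y q)) (\<xi> q)) p = 0"
    by (rule dirderiv_locally_const[OF W]) (rule trans[OF eta_metric[symmetric] eta_phi]; rule in_pts[OF W(1)])
  moreover have "dirderiv M Y (\<lambda>q. g q (\<phi> q (\<xi> q)) (X q)) p = 0"
    by (rule dirderiv_locally_const[OF W]) (simp add: phi_xi g_zero_left in_pts[OF W(1)])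
  moreover have "lie_bracket M \<xi> X p = nabla \<xi> X p - shape p (X p)"
    using nabla_torsion_free[OF W(1) xi X W(2)] nabla_xi_eq_shape[OF W(1) X W(2)] by simp
  moreover have "lie_bracket M Y \<xi> p = shape p y - nabla \<xi> Y p"
    using nabla_torsion_free[OF W(1) Y(1) xi W(2)] nabla_xi_eq_shape[OF W(1) Y(1) W(2)] Y(2) by simp
  moreover have "g p (\<phi> p v) (\<xi> p) = 0" for v using eta_metric[OF p] eta_phi[OF p] by metis
  ultimately have "g p (nabla \<xi> (\<lambda>q. \<phi> q (X q)) p) y + g p (\<phi> p (X p)) (nabla \<xi> Y p)
      - g p (\<phi> p (nabla \<xi> X p - shape p (X p))) y - g p (\<phi> p (shape p y - nabla \<xi> Y p)) (X p)
      = 2 * \<alpha> * g p (\<phi> p (X p)) y"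
    using d_Phi[OF W(1) xi X Y(1) W(2)] nabla_metric[OF W(1) xi smooth_phi[OF W(1) X] Y(1) W(2)]
    by (simp add: d2_def fundamental_form_def wedge12_def Y(2) eta_xi[OF p] phi_xi[OF p] g_zero_left[OF p])
  moreover have "g p (\<phi> p (nabla \<xi> Y p)) (X p) = - g p (\<phi> p (X p)) (nabla \<xi> Y p)"
    using phi_skew[OF p] metric_sym[OF p] by metis
  moreover have "g p (\<phi> p (shape p y)) (X p) = - g p (shape p (\<phi> p (X p))) y"
    using phi_skew[OF p, of "shape p y" "X p"] shape_symmetric[OF p, of y "\<phi> p (X p)"]
      metric_sym[OF p, of y] by simp
  ultimately show "g p (nabla \<xi> (\<lambda>q. \<phi> q (X q)) p - \<phi> p (nabla \<xi> X p)) y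
      = g p ((2 * \<alpha>) *\<^sub>R \<phi> p (X p) - \<phi> p (shape p (X p)) - shape p (\<phi> p (X p))) y"
    by (simp add: lin)
qed

text \<open>It remains to see that \<open>\<nabla>\<^sub>\<xi> \<phi>\<close> anticommutes with \<open>\<phi>\<close>: \<open>(\<nabla>\<^sub>\<xi> \<phi>) \<phi> + \<phi> (\<nabla>\<^sub>\<xi> \<phi>)\<close>
  is the derivative of \<open>\<phi>\<^sup>2 = Id - \<eta> \<otimes> \<xi>\<close> along \<open>\<xi>\<close>, and both \<open>\<xi>\<close> and \<open>\<eta>\<close> are parallel along \<open>\<xi>\<close>.\<close>

lemma trace_shape:
  assumes p: "p \<in> pts M"
  shows "trace (matrix (shape p)) = \<alpha> * (CARD('m) - 1)"
proof (rule trace_almost_paracontact[OF linear_phi[OF p] linear_shape[OF p] linear_eta[OF p] eta_xi[OF p]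
      phi_phi[OF p] eta_shape[OF p]])
  fix v
  let ?N = "\<lambda>v. (2 * \<alpha>) *\<^sub>R \<phi> p v - \<phi> p (shape p v) - shape p (\<phi> p v)"
  define X where "X = const_field M (chart_at M p) v"
  note U = chart_at_p(3,2)[OF p]
  note xi = smooth_xi[OF U(1)]
  have X: "smooth_vfield M (fst (chart_at M p)) X" "X p = v"
    unfolding X_def by (rule ext_smooth[OF p], rule ext_p[OF p])
  let ?\<phi>X = "\<lambda>q. \<phi> q (X q)"
  have eta_X: "smooth_fun M (fst (chart_at M p)) (\<lambda>q. \<eta> q (X q))"
    using eta_form U X unfolding one_form_def by blast
  have "nabla \<xi> (\<lambda>q. \<phi> q (?\<phi>X q)) p = nabla \<xi> (\<lambda>q. X q - \<eta> q (X q) *\<^sub>R \<xi> q) p"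
    by (rule nabla_cong[OF U xi smooth_phi[OF U(1) smooth_phi[OF U(1) X(1)]]])
      (simp_all add: phi_phi in_pts[OF U(1)])
  also have "\<dots> = nabla \<xi> X p - nabla \<xi> (\<lambda>q. \<eta> q (X q) *\<^sub>R \<xi> q) p"
    by (rule nabla_minus_right[OF U xi X(1) smooth_vfield_scale[OF U(1) eta_X xi]])
  also have "nabla \<xi> (\<lambda>q. \<eta> q (X q) *\<^sub>R \<xi> q) p = \<eta> p (nabla \<xi> X p) *\<^sub>R \<xi> p"
    using nabla_leibniz[OF U(1) eta_X xi xi U(2)] dirderiv_eta[OF U(1) xi X(1) U(2)]
      nabla_xi_eq_shape[OF U(1) xi U(2)] shape_xi[OF p] bilinear_rzero[OF bilinear_metric[OF p]]
    by simp
  also have "nabla \<xi> X p - \<eta> p (nabla \<xi> X p) *\<^sub>R \<xi> p = \<phi> p (\<phi> p (nabla \<xi> X p))"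
    by (rule phi_phi[OF p, symmetric])
  finally have "nabla \<xi> (\<lambda>q. \<phi> q (?\<phi>X q)) p = \<phi> p (\<phi> p (nabla \<xi> X p))" .
  moreover have "?N v = nabla \<xi> ?\<phi>X p - \<phi> p (nabla \<xi> X p)"
    using nabla_xi_phi[OF U X(1)] X(2) by simp
  moreover have "?N (\<phi> p v) = nabla \<xi> (\<lambda>q. \<phi> q (?\<phi>X q)) p - \<phi> p (nabla \<xi> ?\<phi>X p)"
    using nabla_xi_phi[OF U smooth_phi[OF U(1) X(1)]] X(2) by simp
  ultimately show "\<phi> p (?N v) + ?N (\<phi> p v) = 0"
    by (simp add: linear_diff[OF linear_phi[OF p]])
qed

section \<open>The second covariant derivative of the Reeb field\<close>

text \<open>The second covariant derivative \<open>\<nabla>\<^sup>2\<^sub>X\<^sub>,\<^sub>Y \<xi>\<close>.  Minus its metric trace is the rough Laplacian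
  of \<open>\<xi>\<close>, and its skew part is the curvature.\<close>

definition nabla2_xi :: "('a, 'm) vfield \<Rightarrow> ('a, 'm) vfield \<Rightarrow> 'a \<Rightarrow> real ^ 'm"
  where "nabla2_xi X Y p = nabla X (nabla Y \<xi>) p - nabla (nabla X Y) \<xi> p"

context
  fixes U p assumes U: "openin (mtop M) U" "p \<in> U"
begin

lemma nabla2_xi_shape:
  assumes X: "smooth_vfield M U X" and Y: "smooth_vfield M U Y"
  shows "nabla2_xi X Y p = nabla X (nabla Y \<xi>) p - shape p (nabla X Y p)"
  by (simp add: nabla2_xi_def nabla_xi_eq_shape[OF U(1) nabla_smooth[OF U(1) X Y] U(2)])

text \<open>Differentiate the self-adjointness of \<open>A\<close> along \<open>X\<close>.\<close>

lemma nabla2_xi_symmetric: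
  assumes X: "smooth_vfield M U X" and Y: "smooth_vfield M U Y" and Z: "smooth_vfield M U Z"
  shows "g p (nabla2_xi X Y p) (Z p) = g p (nabla2_xi X Z p) (Y p)"
proof -
  have p: "p \<in> pts M" by (rule in_pts[OF U])
  note sY = smooth_nabla_xi[OF U(1) Y] and sZ = smooth_nabla_xi[OF U(1) Z]
  have "dirderiv M X (\<lambda>q. g q (nabla Y \<xi> q) (Z q)) p = dirderiv M X (\<lambda>q. g q (nabla Z \<xi> q) (Y q)) p"
    by (rule dirderiv_cong[OF U smooth_metric[OF U(1) sY Z]])
      (simp_all add: nabla_xi_symmetric[OF U(1) Y Z])
  then have "g p (nabla X (nabla Y \<xi>) p) (Z p) + g p (shape p (Y p)) (nabla X Z p)
      = g p (nabla X (nabla Z \<xi>) p) (Y p) + g p (shape p (Z p)) (nabla X Y p)"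
    unfolding nabla_metric[OF U(1) X sY Z U(2)] nabla_metric[OF U(1) X sZ Y U(2)]
    by (simp add: nabla_xi_eq_shape[OF U(1) Y U(2)] nabla_xi_eq_shape[OF U(1) Z U(2)])
  then show ?thesis
    using shape_symmetric[OF p, of "nabla X Y p" "Z p"] shape_symmetric[OF p, of "nabla X Z p" "Y p"]
      metric_sym[OF p, of "nabla X Y p"] metric_sym[OF p, of "nabla X Z p"]
    by (simp add: nabla2_xi_shape[OF X Y] nabla2_xi_shape[OF X Z] g_diff_left[OF p])
qed

lemma nabla2_xi_pointwise_left:
  assumes X: "smooth_vfield M U X" and X': "smooth_vfield M U X'" and Y: "smooth_vfield M U Y"
    and eq: "X p = X' p"
  shows "nabla2_xi X Y p = nabla2_xi X' Y p"
  using nabla_pointwise[OF U X X' smooth_nabla_xi[OF U(1) Y] eq] nabla_pointwise[OF U X X' Y eq]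
  by (simp add: nabla2_xi_shape[OF X Y] nabla2_xi_shape[OF X' Y])

lemma curvature_xi:
  assumes X: "smooth_vfield M U X" and Y: "smooth_vfield M U Y"
  shows "curvature M nabla X Y \<xi> p = nabla2_xi X Y p - nabla2_xi Y X p"
proof -
  have p: "p \<in> pts M" by (rule in_pts[OF U])
  have "nabla (lie_bracket M X Y) \<xi> p = shape p (nabla X Y p - nabla Y X p)"
    using nabla_xi_eq_shape[OF U(1) smooth_lie_bracket[OF U(1) X Y] U(2)]
      nabla_torsion_free[OF U(1) X Y U(2)] by simp
  then show ?thesis
    by (simp add: curvature_def nabla2_xi_shape[OF X Y] nabla2_xi_shape[OF Y X]
        linear_diff[OF linear_shape[OF p]])
qed

text \<open>The trace of \<open>\<nabla>\<^sub>Z A\<close> is \<open>Z(tr A)\<close>, which is \<open>0\<close>.  In a frame, the terms that distinguish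
  the two are sums of \<open>\<epsilon>\<^sub>i \<epsilon>\<^sub>j \<omega>\<^sub>i\<^sub>j a\<^sub>i\<^sub>j\<close> with the skew connection form \<open>\<omega>\<close> of the frame and the symmetric matrix
  \<open>a\<close> of \<open>A\<close>.\<close>

lemma trace_nabla2_xi:
  assumes E: "pseudo_orthonormal_frame M g U E \<epsilon>" and Z: "smooth_vfield M U Z"
  shows "(\<Sum>i\<in>UNIV. \<epsilon> i * g p (nabla2_xi Z (E i) p) (E i p)) = 0"
proof -
  have p: "p \<in> pts M" by (rule in_pts[OF U])
  have sE: "smooth_vfield M U (E i)" for i using E by (simp add: pseudo_orthonormal_frame_def)
  note sDE = smooth_nabla_xi[OF U(1) sE]
  define \<omega> where "\<omega> i j = g p (nabla Z (E i) p) (E j p)" for i j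
  define a where "a i j = g p (shape p (E i p)) (E j p)" for i j
  have \<omega>: "\<omega> i j = - \<omega> j i" for i j
  proof -
    have "dirderiv M Z (\<lambda>q. g q (E i q) (E j q)) p = 0"
      by (rule dirderiv_locally_const[OF U]) (use E in \<open>simp add: pseudo_orthonormal_frame_def\<close>)
    then show ?thesis
      using nabla_metric[OF U(1) Z sE sE U(2), of i j] metric_sym[OF p, of "E i p"] by (simp add: \<omega>_def)
  qed
  have a: "a i j = a j i" for i j
    using shape_symmetric[OF p, of "E i p" "E j p"] metric_sym[OF p, of "E i p"] by (simp add: a_def)
  have "(\<Sum>i\<in>UNIV. \<epsilon> i * g p (shape p (E i p)) (nabla Z (E i) p))
      = (\<Sum>i\<in>UNIV. \<Sum>j\<in>UNIV. \<epsilon> i * \<epsilon> j * \<omega> i j * a i j)"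
  proof (rule sum.cong[OF refl])
    fix i
    have "g p (nabla Z (E i) p) (shape p (E i p)) = (\<Sum>j\<in>UNIV. (\<epsilon> j * \<omega> i j) * g p (E j p) (shape p (E i p)))"
      using frame_expansion[OF E U(2), of "nabla Z (E i) p"]
        bilinear_sum_scale_left[OF bilinear_metric[OF p]] unfolding \<omega>_def by metis
    then show "\<epsilon> i * g p (shape p (E i p)) (nabla Z (E i) p) = (\<Sum>j\<in>UNIV. \<epsilon> i * \<epsilon> j * \<omega> i j * a i j)"
      unfolding a_def metric_sym[OF p, of "shape p (E i p)"] by (simp add: sum_distrib_left mult.assoc)
  qed
  moreover have "(\<Sum>i\<in>UNIV. \<Sum>j\<in>UNIV. \<epsilon> i * \<epsilon> j * \<omega> i j * a i j) = 0" (is "?S = 0")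
  proof -
    have "?S = (\<Sum>j\<in>UNIV. \<Sum>i\<in>UNIV. \<epsilon> i * \<epsilon> j * \<omega> i j * a i j)" by (rule sum.swap)
    also have "\<dots> = (\<Sum>j\<in>UNIV. \<Sum>i\<in>UNIV. - (\<epsilon> j * \<epsilon> i * \<omega> j i * a j i))"
      using \<omega> a by (intro sum.cong refl) (metis (no_types, lifting) mult.commute mult_minus_left mult_minus_right)
    also have "\<dots> = - ?S" by (simp add: sum_negf)
    finally show ?thesis by simp
  qed
  ultimately have mixed: "(\<Sum>i\<in>UNIV. \<epsilon> i * g p (shape p (E i p)) (nabla Z (E i) p)) = 0" by simp
  have "dirderiv M Z (\<lambda>q. \<Sum>i\<in>UNIV. \<epsilon> i * g q (nabla (E i) \<xi> q) (E i q)) p = 0"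
  proof (rule dirderiv_locally_const[OF U])
    fix q assume q: "q \<in> U"
    then have "q \<in> pts M" by (rule in_pts[OF U(1)])
    then show "(\<Sum>i\<in>UNIV. \<epsilon> i * g q (nabla (E i) \<xi> q) (E i q)) = \<alpha> * (CARD('m) - 1)"
      using trace_frame[OF E q linear_shape] trace_shape
      by (simp add: nabla_xi_eq_shape[OF U(1) sE q])
  qed
  then have "(\<Sum>i\<in>UNIV. \<epsilon> i * (g p (nabla Z (nabla (E i) \<xi>) p) (E i p)
      + g p (shape p (E i p)) (nabla Z (E i) p))) = 0"
    by (simp add: dirderiv_sum[OF U smooth_metric[OF U(1) sDE sE]] nabla_metric[OF U(1) Z sDE sE U(2)]
        nabla_xi_eq_shape[OF U(1) sE U(2)])
  then have "(\<Sum>i\<in>UNIV. \<epsilon> i * g p (nabla Z (nabla (E i) \<xi>) p) (E i p)) = 0"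
    using mixed by (simp add: distrib_left sum.distrib)
  moreover have "g p (nabla2_xi Z (E i) p) (E i p)
      = g p (nabla Z (nabla (E i) \<xi>) p) (E i p) - g p (shape p (E i p)) (nabla Z (E i) p)" for i
    using shape_symmetric[OF p, of "nabla Z (E i) p" "E i p"] metric_sym[OF p, of "nabla Z (E i) p"]
    by (simp add: nabla2_xi_shape[OF Z sE] g_diff_left[OF p])
  ultimately show ?thesis
    using mixed by (simp add: right_diff_distrib sum_subtractf)
qed

end

text \<open>Symmetry moves \<open>z\<close> from the outside into the second argument, and exchanging the two arguments of
  \<open>\<nabla>\<^sup>2 \<xi>\<close> costs a curvature term.  The curvature tensor at \<open>p\<close> is defined by coordinate fields, so the
  frame vector in the first argument has to be replaced by one before the exchange and restored
  afterwards.\<close>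

lemma metric_trace_nabla2_xi:
  assumes E: "pseudo_orthonormal_frame M g U E \<epsilon>" and pU: "p \<in> U"
  shows "g p (\<Sum>i\<in>UNIV. \<epsilon> i *\<^sub>R nabla2_xi (E i) (E i) p) z = ricci M nabla p z (\<xi> p)"
proof -
  have U: "openin (mtop M) U" using E by (simp add: pseudo_orthonormal_frame_def)
  have p: "p \<in> pts M" by (rule in_pts[OF U pU])
  let ?c = "chart_at M p"
  let ?W = "U \<inter> fst ?c"
  let ?ext = "const_field M ?c"
  have W: "openin (mtop M) ?W" "p \<in> ?W"
    using openin_Int_chart[OF U chart_at_atlas[OF p]] pU in_chart_at[OF p] by auto
  have EW: "pseudo_orthonormal_frame M g ?W E \<epsilon>"
    using E W(1) smooth_vfield_subset[of U _ ?W] by (auto simp: pseudo_orthonormal_frame_def)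
  have sE: "smooth_vfield M ?W (E i)" for i using EW by (simp add: pseudo_orthonormal_frame_def)
  have ext: "smooth_vfield M ?W (?ext v)" for v using ext_smooth[OF p] smooth_vfield_subset by blast
  have "g p (nabla2_xi (E i) (E i) p) z
      = g p (curvature_at M nabla p (E i p) z (\<xi> p)) (E i p) + g p (nabla2_xi (?ext z) (E i) p) (E i p)" for i
  proof -
    let ?e = "?ext (E i p)"
    have "g p (nabla2_xi (E i) (E i) p) z = g p (nabla2_xi (E i) (?ext z) p) (E i p)"
      using nabla2_xi_symmetric[OF W sE sE ext, of i i z] by (simp add: ext_p[OF p])
    also have "nabla2_xi (E i) (?ext z) p = nabla2_xi ?e (?ext z) p"
      by (rule nabla2_xi_pointwise_left[OF W sE ext ext]) (simp add: ext_p[OF p])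
    also have "\<dots> = curvature_at M nabla p (E i p) z (\<xi> p) + nabla2_xi (?ext z) ?e p"
      using curvature_xi[OF W ext ext, of "E i p" z] curvature_at_field[OF p W smooth_xi[OF W(1)]] by simp
    also have "nabla2_xi (?ext z) ?e p = nabla2_xi (?ext z) (E i) p"
    proof (rule metric_eqI[OF p])
      fix u
      show "g p (nabla2_xi (?ext z) ?e p) u = g p (nabla2_xi (?ext z) (E i) p) u"
        using nabla2_xi_symmetric[OF W ext ext ext, of z "E i p" u] nabla2_xi_symmetric[OF W ext sE ext, of z i u]
        by (simp add: ext_p[OF p])
    qed
    finally show ?thesis by (simp add: g_add_left[OF p])
  qed
  then have "(\<Sum>i\<in>UNIV. \<epsilon> i * g p (nabla2_xi (E i) (E i) p) z) = ricci M nabla p z (\<xi> p)"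
    using trace_nabla2_xi[OF W EW ext, of z] ricci_frame[OF p E pU, of z "\<xi> p"]
    by (simp add: distrib_left sum.distrib)
  then show ?thesis by (simp add: bilinear_sum_scale_left[OF bilinear_metric[OF p]])
qed

text \<open>The symmetry of the Ricci tensor is used here: the Laplacian pairs with \<open>\<xi>\<close> in the second argument
  of \<open>S\<close>, the Ricci operator with \<open>\<xi>\<close> in the first.\<close>

lemma ricci_operator_xi:
  assumes p: "p \<in> pts M"
  shows "ricci_operator M g nabla p (\<xi> p) = - rough_laplacian M g nabla \<xi> p"
proof -
  let ?P = "\<lambda>(E, \<epsilon>). \<exists>U. p \<in> U \<and> pseudo_orthonormal_frame M g U E \<epsilon>"
  obtain E \<epsilon> where E: "(SOME x. ?P x) = (E, \<epsilon>)" by fastforce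
  have "\<exists>x. ?P x"
    using exists_pseudo_orthonormal_frame[OF p]
  proof (elim exE)
    fix U E \<epsilon> assume "p \<in> U \<and> pseudo_orthonormal_frame M g U E \<epsilon>"
    then have "?P (E, \<epsilon>)" unfolding case_prod_conv by (rule exI)
    then show ?thesis by (rule exI)
  qed
  then have "?P (SOME x. ?P x)" by (rule someI_ex)
  then obtain U where U: "p \<in> U" "pseudo_orthonormal_frame M g U E \<epsilon>" unfolding E by blast
  have L: "- rough_laplacian M g nabla \<xi> p = (\<Sum>i\<in>UNIV. \<epsilon> i *\<^sub>R nabla2_xi (E i) (E i) p)"
    unfolding rough_laplacian_def E by (simp add: nabla2_xi_def)
  have L': "g p (- rough_laplacian M g nabla \<xi> p) u = ricci M nabla p (\<xi> p) u" for u
    unfolding L metric_trace_nabla2_xi[OF U(2,1)] by (rule ricci_sym[OF p])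
  show ?thesis unfolding ricci_operator_def
    by (rule the_equality) (use L' metric_eqI[OF p] in metis)+
qed

end

theorem theorem9:
  fixes M :: "('a, 'm::finite) premanifold"
    and n :: nat
    and g :: "'a \<Rightarrow> real ^ 'm \<Rightarrow> real ^ 'm \<Rightarrow> real"
    and \<phi> :: "'a \<Rightarrow> real ^ 'm \<Rightarrow> real ^ 'm"
    and \<xi> :: "('a, 'm) vfield"
    and \<eta> :: "'a \<Rightarrow> real ^ 'm \<Rightarrow> real"
    and \<alpha> :: real
    and nabla :: "('a, 'm) conn"
  assumes "almost_para_kenmotsu M n g \<phi> \<xi> \<eta> \<alpha>"
    and "levi_civita M g nabla"
  shows "harmonic_vfield M g nabla \<xi> \<longleftrightarrow>
    (\<exists>f :: 'a \<Rightarrow> real. \<forall>p\<in>pts M. ricci_operator M g nabla p (\<xi> p) = f p *\<^sub>R \<xi> p)"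
proof -
  interpret almost_para_kenmotsu M n g \<phi> \<xi> \<eta> \<alpha> by (rule assms(1))
  interpret levi_civita M g nabla by (rule assms(2))
  interpret almost_para_kenmotsu_connection M n g \<phi> \<xi> \<eta> \<alpha> nabla by unfold_locales
  have "\<exists>k. k \<noteq> 0 \<and> (\<forall>p\<in>pts M. g p (\<xi> p) (\<xi> p) = k)"
    using metric_xi_xi by (intro exI[of _ 1]) simp
  then have "harmonic_vfield M g nabla \<xi> \<longleftrightarrow>
      (\<exists>f. \<forall>p\<in>pts M. rough_laplacian M g nabla \<xi> p = f p *\<^sub>R \<xi> p)"
    using xi_smooth by (simp add: harmonic_vfield_def)
  also have "\<dots> \<longleftrightarrow> (\<exists>f. \<forall>p\<in>pts M. ricci_operator M g nabla p (\<xi> p) = f p *\<^sub>R \<xi> p)"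
  proof
    assume "\<exists>f. \<forall>p\<in>pts M. rough_laplacian M g nabla \<xi> p = f p *\<^sub>R \<xi> p"
    then obtain f where "\<forall>p\<in>pts M. rough_laplacian M g nabla \<xi> p = f p *\<^sub>R \<xi> p" by blast
    then show "\<exists>f. \<forall>p\<in>pts M. ricci_operator M g nabla p (\<xi> p) = f p *\<^sub>R \<xi> p"
      by (intro exI[of _ "\<lambda>p. - f p"]) (simp add: ricci_operator_xi)
  next
    assume "\<exists>f. \<forall>p\<in>pts M. ricci_operator M g nabla p (\<xi> p) = f p *\<^sub>R \<xi> p"
    then obtain f where "\<forall>p\<in>pts M. ricci_operator M g nabla p (\<xi> p) = f p *\<^sub>R \<xi> p" by blast
    then show "\<exists>f. \<forall>p\<in>pts M. rough_laplacian M g nabla \<xi> p = f p *\<^sub>R \<xi> p"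
      by (intro exI[of _ "\<lambda>p. - f p"]) (simp add: ricci_operator_xi minus_equation_iff)
  qed
  finally show ?thesis .
qed

end
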